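(* For every $\psi\in\mathcal{S}_0(\mathbb{R}^2)$, the distributional shearlet transform $\mathscr{S}_\psi\colon\mathcal{S}_0'(\mathbb{R}^2)\to\mathcal{S}'(\mathbb{S})$ and the distributional shearlet synthesis operator $\mathscr{S}^t_\psi\colon\mathcal{S}'(\mathbb{S})\to\mathcal{S}_0'(\mathbb{R}^2)$ are continuous linear operators.
   Context: Notation: $\mathbb{N}=\{0,1,2,\dots\}$, $\mathbb{R}^\times=\mathbb{R}\setminus\{0\}$, $\langle x\rangle=(1+|x|^2)^{1/2}$. Shearlet group: $\mathbb{S}=\mathbb{R}^2\times\mathbb{R}\times\mathbb{R}^\times$; put $N_s=\begin{bmatrix}1&-s\\0&1\end{bmatrix}$, $A_a=a\begin{bmatrix}1&0\\0&|a|^{-1/2}\end{bmatrix}$. For a function $\psi$ on $\mathbb{R}^2$, $\pi_{b,s,a}\psi(x)=|a|^{-3/4}\psi(A_a^{-1}N_s^{-1}(x-b))$. Lizorkin space: $\mathcal{S}_0(\mathbb{R}^2)=\{\varphi\in\mathcal{S}(\mathbb{R}^2):\int_{\mathbb{R}^2}x^m\varphi(x)\,dx=0\ \text{for all } m\in\mathbb{N}^2\}$ with the relative topology from the Schwartz space $\mathcal{S}(\mathbb{R}^2)$. The space $\mathcal{S}(\mathbb{S})$ consists of all $\Phi\in C^\infty(\mathbb{S})$ such that for all $k_1,k_2,l,m,\alpha_1,\alpha_2,\beta,\gamma\in\mathbb{N}$ the norm $$\sup_{((b_1,b_2),s,a)\in\mathbb{S}}\langle b_1\rangle^{k_1}\langle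 b_2\rangle^{k_2}\langle s\rangle^l\Big(|a|^m+\frac1{|a|^m}\Big)\big|\partial_a^\gamma\partial_s^\beta\partial_{b_2}^{\alpha_2}\partial_{b_1}^{\alpha_1}\Phi((b_1,b_2),s,a)\big|$$ is finite; its topology is defined by these norms. $\mathcal{S}_0'(\mathbb{R}^2)$ and $\mathcal{S}'(\mathbb{S})$ are the topological duals, with the strong dual topologies; $(\cdot,\cdot)$ denotes the (bilinear) dual pairings. On test functions: $\mathcal{S}_\psi f(b,s,a)=\int_{\mathbb{R}^2}f(x)\overline{\pi_{b,s,a}\psi(x)}\,dx$ (shearlet transform) and $\mathcal{S}^t_\psi F(x)=\int_{\mathbb{R}^\times}\int_{\mathbb{R}}\int_{\mathbb{R}^2}F(b,s,a)\,\pi_{b,s,a}\psi(x)\,|a|^{-3}\,db\,ds\,da$ (shearlet synthesis operator). For $\psi\in\mathcal{S}_0(\mathbb{R}^2)$ the paper uses that these are continuous maps $\mathcal{S}_\psi\colon\mathcal{S}_0(\mathbb{R}^2)\to\mathcal{S}(\mathbb{S})$ and $\mathcal{S}^t_\psi\colon\mathcal{S}(\mathbb{S})\to\mathcal{S}_0(\mathbb{R}^2)$. On distributions, for $\psi\in\mathcal{S}_0(\mathbb{R}^2)$: for $f\in\mathcal{S}_0'(\mathbb{R}^2)$, $\mathscr{S}_\psi f\in\mathcal{S}'(\mathbb{S})$ is defined by $(\mathscr{S}_\psi f,\Phi)=(f,\mathcal{S}^t_{\overline\psi}\Phi)$ for $\Phi\in\mathcal{S}(\mathbb{S})$; for $\Psi\in\mathcal{S}'(\mathbb{S})$,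 $\mathscr{S}^t_\psi\Psi\in\mathcal{S}_0'(\mathbb{R}^2)$ is defined by $(\mathscr{S}^t_\psi\Psi,f)=(\Psi,\mathcal{S}_{\overline\psi}f)$ for $f\in\mathcal{S}_0(\mathbb{R}^2)$.
   Formalization: Continuity of the synthesis operator is proved only for ψ such that the shearlet transform with conjugate ψ is continuous from S_0(R^2) to S(𝕊); this fails for some ψ in S_0 (decay only like 1/s), where the defining pairing is undefined. *)

theory Defs
  imports "HOL-Analysis.Analysis"
begin

section \<open>Derivatives and smoothness\<close>

definition partial :: "'a::real_normed_vector \<Rightarrow> ('a \<Rightarrow> 'b::real_normed_vector) \<Rightarrow> 'a \<Rightarrow> 'b"
  where "partial v f = (\<lambda>x. frechet_derivative f (at x) v)"

primrec Ck_on :: "nat \<Rightarrow> 'a::euclidean_space set \<Rightarrow> ('a \<Rightarrow> 'b::real_normed_vector) \<Rightarrow> bool"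
  where
    "Ck_on 0 U f \<longleftrightarrow> continuous_on U f"
  | "Ck_on (Suc k) U f \<longleftrightarrow>
       (\<forall>x\<in>U. f differentiable (at x)) \<and> (\<forall>v\<in>Basis. Ck_on k U (partial v f))"

text \<open>Only meant for open \<open>U\<close>, where it is the usual notion of a \<open>C\<^sup>\<infinity>\<close> function on \<open>U\<close>.\<close>

definition smooth_on :: "'a::euclidean_space set \<Rightarrow> ('a \<Rightarrow> 'b::real_normed_vector) \<Rightarrow> bool"
  where "smooth_on U f \<longleftrightarrow> (\<forall>k. Ck_on k U f)"

definition bracket :: "'a::real_normed_vector \<Rightarrow> real"
  where "bracket x = sqrt (1 + (norm x)\<^sup>2)"

section \<open>Locally convex spaces of complex-valued functions\<close>

text \<open>
  A topological vector space is represented by a topology whose \<open>topspace\<close> is a set of functions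
  into the complex numbers, with pointwise addition and scalar multiplication. Functionals on such
  a space are again functions into the complex numbers, so dual spaces are of the same kind.
\<close>

definition seminorm_topology ::
    "('x \<Rightarrow> complex) set \<Rightarrow> (('x \<Rightarrow> complex) \<Rightarrow> real) set \<Rightarrow> ('x \<Rightarrow> complex) topology"
  where "seminorm_topology V P =
    topology_generated_by
      {{g \<in> V. p (\<lambda>x. g x - f x) < e} | p f e. p \<in> P \<and> f \<in> V \<and> 0 < e}"

definition linear_functional_on ::
    "('x \<Rightarrow> complex) set \<Rightarrow> (('x \<Rightarrow> complex) \<Rightarrow> complex) \<Rightarrow> bool"
  where "linear_functional_on V u \<longleftrightarrow>
    (\<forall>f\<in>V. \<forall>g\<in>V. u (\<lambda>x. f x + g x) = u f + u g) \<and>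
    (\<forall>c. \<forall>f\<in>V. u (\<lambda>x. c * f x) = c * u f)"

definition linear_operator_on ::
    "('x \<Rightarrow> complex) set \<Rightarrow> (('x \<Rightarrow> complex) \<Rightarrow> ('y \<Rightarrow> complex)) \<Rightarrow> bool"
  where "linear_operator_on V L \<longleftrightarrow>
    (\<forall>f\<in>V. \<forall>g\<in>V. L (\<lambda>x. f x + g x) = (\<lambda>y. L f y + L g y)) \<and>
    (\<forall>c. \<forall>f\<in>V. L (\<lambda>x. c * f x) = (\<lambda>y. c * L f y))"

definition continuous_linear_operator ::
    "('x \<Rightarrow> complex) topology \<Rightarrow> ('y \<Rightarrow> complex) topology
      \<Rightarrow> (('x \<Rightarrow> complex) \<Rightarrow> ('y \<Rightarrow> complex)) \<Rightarrow> bool"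
  where "continuous_linear_operator T T' L \<longleftrightarrow>
    linear_operator_on (topspace T) L \<and> continuous_map T T' L"

text \<open>Functionals are set to zero outside the space, so that each has a unique representative.\<close>

definition dual_space :: "('x \<Rightarrow> complex) topology \<Rightarrow> (('x \<Rightarrow> complex) \<Rightarrow> complex) set"
  where "dual_space T =
    {u. linear_functional_on (topspace T) u \<and> continuous_map T euclidean u \<and>
        (\<forall>f. f \<notin> topspace T \<longrightarrow> u f = 0)}"

definition bounded_in :: "('x \<Rightarrow> complex) topology \<Rightarrow> ('x \<Rightarrow> complex) set \<Rightarrow> bool"
  where "bounded_in T B \<longleftrightarrow> B \<subseteq> topspace T \<and>
    (\<forall>U. openin T U \<and> (\<lambda>x. 0) \<in> U \<longrightarrow>
      (\<exists>r>0. \<forall>t\<ge>r. \<forall>f\<in>B. \<exists>g\<in>U. f = (\<lambda>x. complex_of_real t * g x)))"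

definition strong_dual :: "('x \<Rightarrow> complex) topology \<Rightarrow> (('x \<Rightarrow> complex) \<Rightarrow> complex) topology"
  where "strong_dual T =
    seminorm_topology (dual_space T)
      {\<lambda>u. SUP f\<in>B. norm (u f) | B. bounded_in T B \<and> B \<noteq> {}}"

section \<open>The Schwartz and Lizorkin spaces on the plane\<close>

definition schwartz_weight ::
    "nat \<Rightarrow> nat \<Rightarrow> nat \<Rightarrow> (real^2 \<Rightarrow> complex) \<Rightarrow> real^2 \<Rightarrow> real"
  where "schwartz_weight k \<alpha>1 \<alpha>2 \<phi> x =
    bracket x ^ k *
      norm ((partial (axis 2 1) ^^ \<alpha>2) ((partial (axis 1 1) ^^ \<alpha>1) \<phi>) x)"

definition schwartz :: "(real^2 \<Rightarrow> complex) set"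
  where "schwartz = {\<phi>. smooth_on UNIV \<phi> \<and>
    (\<forall>k \<alpha>1 \<alpha>2. bdd_above (range (schwartz_weight k \<alpha>1 \<alpha>2 \<phi>)))}"

definition schwartz_topology :: "(real^2 \<Rightarrow> complex) topology"
  where "schwartz_topology =
    seminorm_topology schwartz {\<lambda>\<phi>. SUP x. schwartz_weight k \<alpha>1 \<alpha>2 \<phi> x | k \<alpha>1 \<alpha>2. True}"

definition lizorkin :: "(real^2 \<Rightarrow> complex) set"
  where "lizorkin = {\<phi> \<in> schwartz. \<forall>m1 m2.
    (\<integral>x. complex_of_real ((x$1) ^ m1 * (x$2) ^ m2) * \<phi> x \<partial>lborel) = 0}"

definition lizorkin_topology :: "(real^2 \<Rightarrow> complex) topology"
  where "lizorkin_topology = subtopology schwartz_topology lizorkin"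

section \<open>The test function space on the shearlet group\<close>

type_synonym shearlet_point = "(real^2) \<times> real \<times> real"

definition shearlet_group :: "shearlet_point set"
  where "shearlet_group = {(b, s, a). a \<noteq> 0}"

definition shearlet_weight ::
    "nat \<Rightarrow> nat \<Rightarrow> nat \<Rightarrow> nat \<Rightarrow> nat \<Rightarrow> nat \<Rightarrow> nat \<Rightarrow> nat \<Rightarrow>
      (shearlet_point \<Rightarrow> complex) \<Rightarrow> shearlet_point \<Rightarrow> real"
  where "shearlet_weight k1 k2 l m \<alpha>1 \<alpha>2 \<beta> \<gamma> \<Phi> = (\<lambda>(b, s, a).
    bracket (b$1) ^ k1 * bracket (b$2) ^ k2 * bracket s ^ l * (\<bar>a\<bar> ^ m + 1 / \<bar>a\<bar> ^ m) *
    norm ((partial (0, 0, 1) ^^ \<gamma>) ((partial (0, 1, 0) ^^ \<beta>)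
      ((partial (axis 2 1, 0, 0) ^^ \<alpha>2) ((partial (axis 1 1, 0, 0) ^^ \<alpha>1) \<Phi>))) (b, s, a)))"

text \<open>
  A function on the shearlet group, which is an open subset of \<open>\<real>\<^sup>2 \<times> \<real> \<times> \<real>\<close>, is represented by
  its extension by zero to the hyperplane \<open>a = 0\<close>. Smoothness and the norms only concern the group.
\<close>

definition shearlet_test :: "(shearlet_point \<Rightarrow> complex) set"
  where "shearlet_test = {\<Phi>. smooth_on shearlet_group \<Phi> \<and>
    (\<forall>k1 k2 l m \<alpha>1 \<alpha>2 \<beta> \<gamma>.
      bdd_above (shearlet_weight k1 k2 l m \<alpha>1 \<alpha>2 \<beta> \<gamma> \<Phi> ` shearlet_group)) \<and>
    (\<forall>y. y \<notin> shearlet_group \<longrightarrow> \<Phi> y = 0)}"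

definition shearlet_test_topology :: "(shearlet_point \<Rightarrow> complex) topology"
  where "shearlet_test_topology =
    seminorm_topology shearlet_test
      {\<lambda>\<Phi>. SUP y\<in>shearlet_group. shearlet_weight k1 k2 l m \<alpha>1 \<alpha>2 \<beta> \<gamma> \<Phi> y
        | k1 k2 l m \<alpha>1 \<alpha>2 \<beta> \<gamma>. True}"

section \<open>The shearlet transform and the synthesis operator\<close>

definition shear_matrix :: "real \<Rightarrow> real^2^2"
  where "shear_matrix s = vector [vector [1, - s], vector [0, 1]]"

definition dilation_matrix :: "real \<Rightarrow> real^2^2"
  where "dilation_matrix a = a *\<^sub>R vector [vector [1, 0], vector [0, \<bar>a\<bar> powr (- 1 / 2)]]"

definition shearlet_rep ::
    "real^2 \<Rightarrow> real \<Rightarrow> real \<Rightarrow> (real^2 \<Rightarrow> complex) \<Rightarrow> real^2 \<Rightarrow> complex"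
  where "shearlet_rep b s a \<psi> x =
    complex_of_real (\<bar>a\<bar> powr (- 3 / 4)) *
      \<psi> (matrix_inv (dilation_matrix a) *v (matrix_inv (shear_matrix s) *v (x - b)))"

definition shearlet_transform ::
    "(real^2 \<Rightarrow> complex) \<Rightarrow> (real^2 \<Rightarrow> complex) \<Rightarrow> shearlet_point \<Rightarrow> complex"
  where "shearlet_transform \<psi> f = (\<lambda>(b, s, a).
    if a = 0 then 0 else (\<integral>x. f x * cnj (shearlet_rep b s a \<psi> x) \<partial>lborel))"

definition shearlet_synthesis ::
    "(real^2 \<Rightarrow> complex) \<Rightarrow> (shearlet_point \<Rightarrow> complex) \<Rightarrow> real^2 \<Rightarrow> complex"
  where "shearlet_synthesis \<psi> F x =
    (LINT a:-{0}|lborel. \<integral>s. \<integral>b.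
      F (b, s, a) * shearlet_rep b s a \<psi> x * complex_of_real (\<bar>a\<bar> powr (- 3)) \<partial>lborel \<partial>lborel)"

text \<open>
  The restrictions to the test spaces below implement the convention in \<open>dual_space\<close>. The synthesis
  of \<open>\<Psi>\<close> evaluates \<open>\<Psi>\<close> at shearlet transforms of Lizorkin functions, so it is the intended operator
  only if these transforms lie in \<open>shearlet_test\<close>. This is not automatic: for \<open>a = 1\<close>, \<open>b = 0\<close> and
  \<open>s \<rightarrow> \<infinity>\<close>, \<open>s\<close> times the transform of \<open>f\<close> tends to the product of \<open>\<integral> f(t,0) dt\<close> and the conjugate
  of \<open>\<integral> \<psi>(t,0) dt\<close>, and vanishing moments do not make these line integrals zero.
\<close>

definition dist_shearlet_transform ::
    "(real^2 \<Rightarrow> complex) \<Rightarrow> ((real^2 \<Rightarrow> complex) \<Rightarrow> complex) \<Rightarrow>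
      (shearlet_point \<Rightarrow> complex) \<Rightarrow> complex"
  where "dist_shearlet_transform \<psi> f = (\<lambda>\<Phi>.
    if \<Phi> \<in> shearlet_test then f (shearlet_synthesis (\<lambda>x. cnj (\<psi> x)) \<Phi>) else 0)"

definition dist_shearlet_synthesis ::
    "(real^2 \<Rightarrow> complex) \<Rightarrow> ((shearlet_point \<Rightarrow> complex) \<Rightarrow> complex) \<Rightarrow>
      (real^2 \<Rightarrow> complex) \<Rightarrow> complex"
  where "dist_shearlet_synthesis \<psi> \<Psi> = (\<lambda>f.
    if f \<in> lizorkin then \<Psi> (shearlet_transform (\<lambda>x. cnj (\<psi> x)) f) else 0)"

end

theory Submission
  imports Defs "HOL-Probability.Sinc_Integral"
begin

text \<open>
  Both operators are transposes of maps between the test spaces, and the transpose of a continuous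
  linear map is continuous for the strong dual topologies, because continuous linear maps preserve
  bounded sets. For the first operator this leaves the continuity of the synthesis operator from the
  test space on the group to the Lizorkin space. It is a superposition of the functions
  \<open>\<psi>(M\<^sub>\<omega>(x - b))\<close> with a density that decays faster than every power of \<open>1 + \<bar>\<omega>\<bar>\<close> and \<open>1 / \<bar>a\<bar>\<close>; the linear maps \<open>M\<^sub>\<omega>\<close> and
  their inverses grow at most polynomially in these quantities. Differentiation under the
  integral multiplies the density by entries of \<open>M\<^sub>\<omega>\<close> and differentiates \<open>\<psi>\<close>, so all Schwartz
  seminorms are bounded by a single undifferentiated seminorm of the density. The moments vanish by
  Fubini's theorem, since an affine change of variables turns monomials into polynomials.
\<close>

section \<open>Seminorm topologies and strong duals\<close>

definition function_subspace :: "('x \<Rightarrow> complex) set \<Rightarrow> bool"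
  where "function_subspace V \<longleftrightarrow> (\<lambda>x. 0) \<in> V \<and>
    (\<forall>f\<in>V. \<forall>g\<in>V. (\<lambda>x. f x + g x) \<in> V) \<and> (\<forall>c. \<forall>f\<in>V. (\<lambda>x. c * f x) \<in> V)"

lemma function_subspaceD:
  assumes "function_subspace V"
  shows "(\<lambda>x. 0) \<in> V" "f \<in> V \<Longrightarrow> g \<in> V \<Longrightarrow> (\<lambda>x. f x + g x) \<in> V" "f \<in> V \<Longrightarrow> (\<lambda>x. c * f x) \<in> V"
  using assms unfolding function_subspace_def by auto

lemma function_subspace_diff:
  assumes "function_subspace V" "f \<in> V" "g \<in> V"
  shows "(\<lambda>x. f x - g x) \<in> V"
  using function_subspaceD(2)[OF assms(1,2) function_subspaceD(3)[OF assms(1,3), of "-1"]] by simp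

lemma openin_seminorm_ball:
  assumes "p \<in> P" "f \<in> V" "0 < e"
  shows "openin (seminorm_topology V P) {g \<in> V. p (\<lambda>x. g x - f x) < e}"
  unfolding seminorm_topology_def by (rule topology_generated_by_Basis) (use assms in blast)

lemma topspace_seminorm_topology:
  assumes "P \<noteq> {}" "\<And>p. p \<in> P \<Longrightarrow> p (\<lambda>x. 0) = 0"
  shows "topspace (seminorm_topology V P) = V"
proof
  show "topspace (seminorm_topology V P) \<subseteq> V"
    unfolding seminorm_topology_def topology_generated_by_topspace by auto
  show "V \<subseteq> topspace (seminorm_topology V P)"
  proof
    fix f assume f: "f \<in> V"
    obtain p where p: "p \<in> P" using assms by auto
    have "f \<in> {g \<in> V. p (\<lambda>x. g x - f x) < 1}"
      using f assms(2)[OF p] by simp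
    with openin_seminorm_ball[OF p f zero_less_one] show "f \<in> topspace (seminorm_topology V P)"
      using openin_subset by blast
  qed
qed

lemma continuous_map_seminorm_topologyI:
  assumes P: "P \<noteq> {}" "\<And>p. p \<in> P \<Longrightarrow> p (\<lambda>x. 0) = 0"
    and triangle: "\<And>p f g h. p \<in> P \<Longrightarrow> f \<in> V \<Longrightarrow> g \<in> V \<Longrightarrow> h \<in> V \<Longrightarrow>
      p (\<lambda>x. f x - h x) \<le> p (\<lambda>x. f x - g x) + p (\<lambda>x. g x - h x)"
    and L: "\<And>f. f \<in> topspace X \<Longrightarrow> L f \<in> V"
    and cont: "\<And>p f e. p \<in> P \<Longrightarrow> f \<in> topspace X \<Longrightarrow> 0 < e \<Longrightarrow>
      \<exists>U. openin X U \<and> f \<in> U \<and> (\<forall>g\<in>U. p (\<lambda>x. L g x - L f x) < e)"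
  shows "continuous_map X (seminorm_topology V P) L"
proof -
  have "continuous_map X (seminorm_topology V P) L \<longleftrightarrow>
    continuous_map X (topology_generated_by
      {{g \<in> V. p (\<lambda>x. g x - f x) < e} | p f e. p \<in> P \<and> f \<in> V \<and> 0 < e}) L"
    by (simp add: seminorm_topology_def)
  also have "\<dots>"
  proof (rule continuous_on_generated_topo)
    fix W assume "W \<in> {{g \<in> V. p (\<lambda>x. g x - f x) < e} | p f e. p \<in> P \<and> f \<in> V \<and> 0 < e}"
    then obtain p f e where W: "W = {g \<in> V. p (\<lambda>x. g x - f x) < e}" and p: "p \<in> P"
      and f: "f \<in> V" and e: "0 < e" by blast
    show "openin X (L -` W \<inter> topspace X)"
    proof (subst openin_subopen, safe)
      fix g assume g: "L g \<in> W" "g \<in> topspace X"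
      then have "0 < e - p (\<lambda>x. L g x - f x)" using W by auto
      from cont[OF p g(2) this] obtain U where U: "openin X U" "g \<in> U"
        "\<And>h. h \<in> U \<Longrightarrow> p (\<lambda>x. L h x - L g x) < e - p (\<lambda>x. L g x - f x)" by blast
      have "U \<subseteq> L -` W \<inter> topspace X"
      proof
        fix h assume h: "h \<in> U"
        then have ht: "h \<in> topspace X" using U(1) openin_subset by blast
        have "p (\<lambda>x. L h x - f x) \<le> p (\<lambda>x. L h x - L g x) + p (\<lambda>x. L g x - f x)"
          by (rule triangle[OF p L[OF ht] L[OF g(2)] f])
        also have "\<dots> < e" using U(3)[OF h] by simp
        finally show "h \<in> L -` W \<inter> topspace X" using W L[OF ht] ht by simp
      qed
      then show "\<exists>T. openin X T \<and> g \<in> T \<and> T \<subseteq> L -` W \<inter> topspace X" using U by blast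
    qed
  next
    have "topspace (seminorm_topology V P) = V"
      using P by (rule topspace_seminorm_topology)
    then have "\<Union> {{g \<in> V. p (\<lambda>x. g x - f x) < e} | p f e. p \<in> P \<and> f \<in> V \<and> 0 < e} = V"
      by (simp add: seminorm_topology_def)
    with L show "L ` topspace X \<subseteq> \<Union> {{g \<in> V. p (\<lambda>x. g x - f x) < e} | p f e. p \<in> P \<and> f \<in> V \<and> 0 < e}"
      by auto
  qed
  finally show ?thesis .
qed

lemma dual_spaceD:
  assumes "u \<in> dual_space T"
  shows "f \<in> topspace T \<Longrightarrow> g \<in> topspace T \<Longrightarrow> u (\<lambda>x. f x + g x) = u f + u g"
    and "f \<in> topspace T \<Longrightarrow> u (\<lambda>x. c * f x) = c * u f"
    and "continuous_map T euclidean u"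
    and "f \<notin> topspace T \<Longrightarrow> u f = 0"
  using assms unfolding dual_space_def linear_functional_on_def by auto

lemma bounded_inD:
  assumes "bounded_in T B" "openin T U" "(\<lambda>x. 0) \<in> U"
  shows "\<exists>r>0. \<forall>t\<ge>r. \<forall>f\<in>B. \<exists>g\<in>U. f = (\<lambda>x. complex_of_real t * g x)"
  using assms(1)[unfolded bounded_in_def, THEN conjunct2, THEN spec, THEN mp, OF conjI[OF assms(2,3)]] .

lemma bdd_above_dual_bounded:
  assumes T: "(\<lambda>x. 0) \<in> topspace T" and u: "u \<in> dual_space T" and B: "bounded_in T B"
  shows "bdd_above ((\<lambda>f. norm (u f)) ` B)"
proof -
  let ?U = "{f \<in> topspace T. u f \<in> ball 0 1}"
  have "openin T ?U"
    by (rule openin_continuous_map_preimage[OF dual_spaceD(3)[OF u]]) simp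
  moreover have "u (\<lambda>x. 0) = 0" using dual_spaceD(2)[OF u T, of 0] by simp
  then have "(\<lambda>x. 0) \<in> ?U" using T by simp
  ultimately have "\<exists>r>0. \<forall>t\<ge>r. \<forall>f\<in>B. \<exists>g\<in>?U. f = (\<lambda>x. complex_of_real t * g x)"
    by (rule bounded_inD[OF B])
  then obtain r where r: "r > 0"
    "\<forall>t\<ge>r. \<forall>f\<in>B. \<exists>g\<in>?U. f = (\<lambda>x. complex_of_real t * g x)"
    by (elim exE conjE) (rule that, assumption+)
  show ?thesis
  proof (rule bdd_aboveI2)
    fix f assume "f \<in> B"
    then obtain g where g: "g \<in> ?U" "f = (\<lambda>x. complex_of_real r * g x)"
      using r(2)[THEN spec, THEN mp, OF order_refl, THEN bspec] by blast
    have "u f = complex_of_real r * u g" using g dual_spaceD(2)[OF u] by simp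
    then have "norm (u f) = r * norm (u g)" using r(1) by (simp add: norm_mult)
    also have "\<dots> \<le> r * 1" using g(1) r(1) by (intro mult_left_mono) auto
    finally show "norm (u f) \<le> r" by simp
  qed
qed

lemma bdd_above_dual_diff_bounded:
  assumes T: "(\<lambda>x. 0) \<in> topspace T" and u: "u \<in> dual_space T" and v: "v \<in> dual_space T"
    and B: "bounded_in T B"
  shows "bdd_above ((\<lambda>f. norm (u f - v f)) ` B)"
proof -
  obtain C D where C: "\<And>f. f \<in> B \<Longrightarrow> norm (u f) \<le> C" and D: "\<And>f. f \<in> B \<Longrightarrow> norm (v f) \<le> D"
    using bdd_above_dual_bounded[OF T u B] bdd_above_dual_bounded[OF T v B]
    unfolding bdd_above_def by auto
  show ?thesis
    by (rule bdd_aboveI2[where M="C + D"]) (use C D in \<open>smt (verit) norm_triangle_ineq4\<close>)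
qed

lemma bounded_in_zero:
  assumes "(\<lambda>x. 0) \<in> topspace T"
  shows "bounded_in T {\<lambda>x. 0}"
  using assms unfolding bounded_in_def by (auto intro!: exI[of _ "1::real"] bexI[of _ "\<lambda>x. 0"])

lemma strong_dual_seminorms:
  assumes "(\<lambda>x. 0) \<in> topspace T"
  defines "P \<equiv> {\<lambda>u. SUP f\<in>B. norm (u f :: complex) | B. bounded_in T B \<and> B \<noteq> {}}"
  shows "P \<noteq> {}" "p \<in> P \<Longrightarrow> p (\<lambda>x. 0) = 0"
proof -
  show "P \<noteq> {}" unfolding P_def using bounded_in_zero[OF assms(1)] by blast
  assume "p \<in> P"
  then obtain B where "p = (\<lambda>u. SUP f\<in>B. norm (u f :: complex))" "B \<noteq> {}" unfolding P_def by blast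
  then show "p (\<lambda>x. 0) = 0" by simp
qed

lemma topspace_strong_dual:
  assumes "(\<lambda>x. 0) \<in> topspace T"
  shows "topspace (strong_dual T) = dual_space T"
  unfolding strong_dual_def
  by (rule topspace_seminorm_topology) (use strong_dual_seminorms[OF assms] in auto)

lemma linear_operator_onD:
  assumes "linear_operator_on V L"
  shows "f \<in> V \<Longrightarrow> g \<in> V \<Longrightarrow> L (\<lambda>x. f x + g x) = (\<lambda>y. L f y + L g y)"
    and "f \<in> V \<Longrightarrow> L (\<lambda>x. c * f x) = (\<lambda>y. c * L f y)"
  using assms unfolding linear_operator_on_def by simp_all

lemma bounded_in_image:
  assumes T: "function_subspace (topspace T)"
    and L: "linear_operator_on (topspace T) L" "continuous_map T T' L"
    and B: "bounded_in T B"
  shows "bounded_in T' (L ` B)"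
  unfolding bounded_in_def
proof (intro conjI allI impI)
  show "L ` B \<subseteq> topspace T'"
    using B L(2) unfolding bounded_in_def continuous_map_def by blast
  fix U assume U: "openin T' U \<and> (\<lambda>x. 0) \<in> U"
  have L0: "L (\<lambda>x. 0) = (\<lambda>y. 0)"
    using linear_operator_onD(2)[OF L(1) function_subspaceD(1)[OF T], of 0] by simp
  have "openin T {f \<in> topspace T. L f \<in> U}"
    using U L(2) openin_continuous_map_preimage by blast
  moreover have "(\<lambda>x. 0) \<in> {f \<in> topspace T. L f \<in> U}"
    using U L0 function_subspaceD(1)[OF T] by simp
  ultimately have "\<exists>r>0. \<forall>t\<ge>r. \<forall>f\<in>B.
      \<exists>g\<in>{f \<in> topspace T. L f \<in> U}. f = (\<lambda>x. complex_of_real t * g x)"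
    by (rule bounded_inD[OF B])
  then obtain r where r: "r > 0" "\<forall>t\<ge>r. \<forall>f\<in>B.
      \<exists>g\<in>{f \<in> topspace T. L f \<in> U}. f = (\<lambda>x. complex_of_real t * g x)"
    by (elim exE conjE) (rule that, assumption+)
  show "\<exists>r>0. \<forall>t\<ge>r. \<forall>f\<in>L ` B. \<exists>g\<in>U. f = (\<lambda>x. complex_of_real t * g x)"
  proof (intro exI[of _ r] conjI allI impI ballI)
    fix t h assume t: "t \<ge> r" "h \<in> L ` B"
    then obtain f where f: "f \<in> B" "h = L f" by blast
    from r(2)[THEN spec, THEN mp, OF t(1), THEN bspec, OF f(1)] obtain g where g: "g \<in> topspace T" "L g \<in> U"
      "f = (\<lambda>x. complex_of_real t * g x)" by blast
    have "h = (\<lambda>y. complex_of_real t * L g y)"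
      unfolding f(2) g(3) by (rule linear_operator_onD(2)[OF L(1) g(1)])
    then show "\<exists>g\<in>U. h = (\<lambda>x. complex_of_real t * g x)" using g(2) by blast
  qed (use r in auto)
qed

theorem continuous_linear_operator_transpose:
  assumes T: "function_subspace (topspace T)" and T': "function_subspace (topspace T')"
    and L: "linear_operator_on (topspace T) L" "continuous_map T T' L"
  shows "continuous_linear_operator (strong_dual T') (strong_dual T)
    (\<lambda>u \<Phi>. if \<Phi> \<in> topspace T then u (L \<Phi>) else 0)" (is "continuous_linear_operator _ _ ?L'")
proof -
  note z = function_subspaceD(1)[OF T] and z' = function_subspaceD(1)[OF T']
  have LT: "L \<Phi> \<in> topspace T'" if "\<Phi> \<in> topspace T" for \<Phi>
    using L(2) that unfolding continuous_map_def by blast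
  have dual: "?L' u \<in> dual_space T" if u: "u \<in> dual_space T'" for u
    unfolding dual_space_def
  proof (intro CollectI conjI)
    show "linear_functional_on (topspace T) (?L' u)"
      unfolding linear_functional_on_def
      by (simp add: linear_operator_onD[OF L(1)] LT dual_spaceD(1,2)[OF u] function_subspaceD[OF T])
    have "continuous_map T euclidean (u \<circ> L)"
      using L(2) dual_spaceD(3)[OF u] by (rule continuous_map_compose)
    then show "continuous_map T euclidean (?L' u)"
      by (rule continuous_map_eq) simp
  qed simp
  have "continuous_map (strong_dual T') (strong_dual T) ?L'"
    unfolding strong_dual_def[of T]
  proof (rule continuous_map_seminorm_topologyI)
    fix p f g h
    assume p: "p \<in> {\<lambda>u. SUP f\<in>B. norm (u f :: complex) |B. bounded_in T B \<and> B \<noteq> {}}"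
      and f: "f \<in> dual_space T" and g: "g \<in> dual_space T" and h: "h \<in> dual_space T"
    then obtain B where pB: "p = (\<lambda>u. SUP f\<in>B. norm (u f))" and B: "bounded_in T B" "B \<noteq> {}"
      by blast
    show "p (\<lambda>x. f x - h x) \<le> p (\<lambda>x. f x - g x) + p (\<lambda>x. g x - h x)"
      unfolding pB
    proof (rule cSUP_least[OF B(2)])
      fix x assume x: "x \<in> B"
      have "norm (f x - h x) \<le> norm (f x - g x) + norm (g x - h x)"
        by (metis diff_add_cancel add_diff_eq norm_triangle_ineq)
      also have "\<dots> \<le> (SUP x\<in>B. norm (f x - g x)) + (SUP x\<in>B. norm (g x - h x))"
        by (intro add_mono cSUP_upper x bdd_above_dual_diff_bounded[OF z] f g h B(1))
      finally show "norm (f x - h x) \<le> (SUP x\<in>B. norm (f x - g x)) + (SUP x\<in>B. norm (g x - h x))" .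
    qed
  next
    fix p :: "(('a \<Rightarrow> complex) \<Rightarrow> complex) \<Rightarrow> real" and f and e :: real
    assume p: "p \<in> {\<lambda>u. SUP f\<in>B. norm (u f) |B. bounded_in T B \<and> B \<noteq> {}}"
      and f: "f \<in> topspace (strong_dual T')" and e: "0 < e"
    then obtain B where pB: "p = (\<lambda>u. SUP f\<in>B. norm (u f))" and B: "bounded_in T B" "B \<noteq> {}"
      by blast
    have f': "f \<in> dual_space T'" using f topspace_strong_dual[OF z'] by simp
    have LB: "bounded_in T' (L ` B)" by (rule bounded_in_image[OF T L B(1)])
    let ?U = "{g \<in> dual_space T'. (SUP x\<in>L ` B. norm (g x - f x)) < e}"
    have "openin (strong_dual T') ?U"
      unfolding strong_dual_def
      by (rule openin_seminorm_ball[where p = "\<lambda>u. SUP x\<in>L ` B. norm (u x)", OF _ f' e])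
        (use LB B in blast)
    moreover have "f \<in> ?U" using f' e B(2) by simp
    moreover have "p (\<lambda>x. ?L' g x - ?L' f x) < e" if "g \<in> ?U" for g
    proof -
      have "p (\<lambda>x. ?L' g x - ?L' f x) = (SUP x\<in>B. norm (g (L x) - f (L x)))"
        unfolding pB using B(1) unfolding bounded_in_def by (intro SUP_cong) auto
      also have "\<dots> = (SUP x\<in>L ` B. norm (g x - f x))" by (simp add: image_image)
      also have "\<dots> < e" using that by blast
      finally show ?thesis .
    qed
    ultimately show "\<exists>U. openin (strong_dual T') U \<and> f \<in> U \<and> (\<forall>g\<in>U. p (\<lambda>x. ?L' g x - ?L' f x) < e)"
      by blast
  qed (use strong_dual_seminorms[OF z] dual topspace_strong_dual[OF z'] in auto)
  then show ?thesis
    unfolding continuous_linear_operator_def linear_operator_on_def by auto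
qed

section \<open>Smooth functions\<close>

lemma partial_eqI: "(f has_derivative D) (at x) \<Longrightarrow> partial v f x = D v"
  unfolding partial_def using frechet_derivative_at by metis

lemma partial_has_derivative: "f differentiable (at x) \<Longrightarrow> (f has_derivative (\<lambda>v. partial v f x)) (at x)"
  unfolding partial_def using frechet_derivative_works by (metis eta_contract_eq)

lemma differentiable_transform_open:
  assumes "open U" "x \<in> U" "\<And>y. y \<in> U \<Longrightarrow> f y = g y" "f differentiable (at x)"
  shows "g differentiable (at x)"
  using assms has_derivative_transform_within_open[of f _ x UNIV U g]
  unfolding differentiable_def by auto

lemma partial_cong_open:
  assumes "open U" "x \<in> U" "\<And>y. y \<in> U \<Longrightarrow> f y = g y"
  shows "partial v f x = partial v g x"
proof -
  have "(f has_derivative D) (at x) \<longleftrightarrow> (g has_derivative D) (at x)" for D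
    using assms has_derivative_transform_within_open[of f D x UNIV U g]
      has_derivative_transform_within_open[of g D x UNIV U f] by auto
  then show ?thesis unfolding partial_def frechet_derivative_def by simp
qed

lemma Ck_on_cong:
  assumes "open U" "\<And>y. y \<in> U \<Longrightarrow> f y = g y" "Ck_on k U f"
  shows "Ck_on k U g"
  using assms
proof (induction k arbitrary: f g)
  case 0
  then show ?case by (simp cong: continuous_on_cong)
next
  case (Suc k)
  have "g differentiable (at x)" if "x \<in> U" for x
    using differentiable_transform_open[OF Suc.prems(1) that Suc.prems(2)] Suc.prems(3) that by simp
  moreover have "Ck_on k U (partial v g)" if v: "v \<in> Basis" for v
  proof (rule Suc.IH[OF Suc.prems(1)])
    show "partial v f x = partial v g x" if "x \<in> U" for x
      using partial_cong_open[OF Suc.prems(1) that Suc.prems(2)] .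
    show "Ck_on k U (partial v f)" using Suc.prems(3) v by simp
  qed
  ultimately show ?case by simp
qed

lemma partial_add:
  assumes "f differentiable (at x)" "g differentiable (at x)"
  shows "partial v (\<lambda>x. f x + g x) x = partial v f x + partial v g x"
  by (rule partial_eqI[OF has_derivative_add[OF partial_has_derivative partial_has_derivative]]) fact+

lemma partial_bounded_linear:
  assumes "bounded_linear h" "f differentiable (at x)"
  shows "partial v (\<lambda>x. h (f x)) x = h (partial v f x)"
  by (rule partial_eqI[OF bounded_linear.has_derivative[OF assms(1) partial_has_derivative]]) fact

lemma Ck_on_add:
  assumes "open U" "Ck_on k U f" "Ck_on k U g"
  shows "Ck_on k U (\<lambda>x. f x + g x)"
  using assms
proof (induction k arbitrary: f g)
  case 0
  then show ?case by (simp add: continuous_on_add)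
next
  case (Suc k)
  have "Ck_on k U (partial v (\<lambda>x. f x + g x))" if v: "v \<in> Basis" for v
    by (rule Ck_on_cong[OF Suc.prems(1) _ Suc.IH[of "partial v f" "partial v g"]])
      (use Suc.prems v in \<open>auto simp: partial_add\<close>)
  then show ?case using Suc.prems by simp
qed

lemma Ck_on_bounded_linear:
  assumes "bounded_linear h" "open U" "Ck_on k U f"
  shows "Ck_on k U (\<lambda>x. h (f x))"
  using assms(2,3)
proof (induction k arbitrary: f)
  case 0
  then show ?case using bounded_linear.continuous_on[OF assms(1)] by auto
next
  case (Suc k)
  have "Ck_on k U (partial v (\<lambda>x. h (f x)))" if v: "v \<in> Basis" for v
    by (rule Ck_on_cong[OF Suc.prems(1) _ Suc.IH[of "partial v f"]])
      (use Suc.prems v assms(1) in \<open>auto simp: partial_bounded_linear\<close>)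
  then show ?case using Suc.prems bounded_linear.has_derivative[OF assms(1)] unfolding differentiable_def Ck_on.simps by blast
qed

lemma smooth_on_add:
  "open U \<Longrightarrow> smooth_on U f \<Longrightarrow> smooth_on U g \<Longrightarrow> smooth_on U (\<lambda>x. f x + g x)"
  unfolding smooth_on_def by (auto intro: Ck_on_add)

lemma smooth_on_bounded_linear:
  "bounded_linear h \<Longrightarrow> open U \<Longrightarrow> smooth_on U f \<Longrightarrow> smooth_on U (\<lambda>x. h (f x))"
  unfolding smooth_on_def by (auto intro: Ck_on_bounded_linear)

lemma smooth_on_const:
  assumes "open U"
  shows "smooth_on U (\<lambda>x. c)"
proof -
  have "Ck_on k U (\<lambda>x. c)" for k
  proof (induction k arbitrary: c)
    case (Suc k)
    have "partial v (\<lambda>x. c) = (\<lambda>x. 0)" for v :: 'a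
      by (rule ext, rule partial_eqI[of _ "\<lambda>_. 0"]) simp
    with Suc show ?case by simp
  qed simp
  then show ?thesis unfolding smooth_on_def by blast
qed

lemma smooth_on_differentiable: "smooth_on U f \<Longrightarrow> x \<in> U \<Longrightarrow> f differentiable (at x)"
  unfolding smooth_on_def using Ck_on.simps(2)[of 0 U f] by blast

lemma smooth_on_partial: "smooth_on U f \<Longrightarrow> v \<in> Basis \<Longrightarrow> smooth_on U (partial v f)"
  unfolding smooth_on_def using Ck_on.simps(2) by blast

lemma smooth_on_continuous_on: "smooth_on U f \<Longrightarrow> continuous_on U f"
  unfolding smooth_on_def using Ck_on.simps(1) by blast

lemma smooth_on_foldr_partial:
  "smooth_on U f \<Longrightarrow> set vs \<subseteq> Basis \<Longrightarrow> smooth_on U (foldr partial vs f)"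
  by (induction vs) (auto intro: smooth_on_partial)

lemma foldr_partial_add:
  assumes "open U" "smooth_on U f" "smooth_on U g" "set vs \<subseteq> Basis" "x \<in> U"
  shows "foldr partial vs (\<lambda>x. f x + g x) x = foldr partial vs f x + foldr partial vs g x"
  using assms(4,5)
proof (induction vs arbitrary: x)
  case (Cons v vs)
  have "partial v (foldr partial vs (\<lambda>x. f x + g x)) x =
      partial v (\<lambda>x. foldr partial vs f x + foldr partial vs g x) x"
    by (rule partial_cong_open[OF assms(1) Cons.prems(2)]) (use Cons in auto)
  also have "\<dots> = partial v (foldr partial vs f) x + partial v (foldr partial vs g) x"
    using Cons.prems assms(2,3)
    by (intro partial_add smooth_on_differentiable smooth_on_foldr_partial) auto
  finally show ?case by simp
qed simp

lemma foldr_partial_bounded_linear: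
  assumes "bounded_linear h" "open U" "smooth_on U f" "set vs \<subseteq> Basis" "x \<in> U"
  shows "foldr partial vs (\<lambda>x. h (f x)) x = h (foldr partial vs f x)"
  using assms(4,5)
proof (induction vs arbitrary: x)
  case (Cons v vs)
  have "partial v (foldr partial vs (\<lambda>x. h (f x))) x = partial v (\<lambda>x. h (foldr partial vs f x)) x"
    by (rule partial_cong_open[OF assms(2) Cons.prems(2)]) (use Cons in auto)
  also have "\<dots> = h (partial v (foldr partial vs f) x)"
    using Cons.prems assms(1,3)
    by (intro partial_bounded_linear smooth_on_differentiable smooth_on_foldr_partial) auto
  finally show ?case by simp
qed simp

lemma foldr_partial_zero:
  "foldr partial vs (\<lambda>x. 0) = (\<lambda>x. 0)"
proof (induction vs)
  case (Cons v vs)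
  have "partial v (\<lambda>x. 0) = (\<lambda>x. 0)" by (rule ext, rule partial_eqI[of _ "\<lambda>_. 0"]) simp
  with Cons show ?case by simp
qed simp

lemma second_difference:
  fixes f :: "'a::euclidean_space \<Rightarrow> real"
  assumes f: "\<And>x. f differentiable (at x)" "\<And>x. partial u f differentiable (at x)" and t: "t > 0"
  obtains \<xi> \<eta> where "0 < \<xi>" "\<xi> < t" "0 < \<eta>" "\<eta> < t"
    "f (x + t *\<^sub>R u + t *\<^sub>R v) - f (x + t *\<^sub>R u) - f (x + t *\<^sub>R v) + f x
      = t * (t * partial v (partial u f) (x + \<xi> *\<^sub>R u + \<eta> *\<^sub>R v))"
proof -
  have d: "((\<lambda>s. g (y + s *\<^sub>R w)) has_real_derivative partial w g (y + s *\<^sub>R w)) (at s)"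
    if g: "\<And>x. g differentiable (at x)" for g :: "'a \<Rightarrow> real" and y w s
  proof -
    interpret D: bounded_linear "\<lambda>v. partial v g (y + s *\<^sub>R w)"
      using has_derivative_bounded_linear[OF partial_has_derivative[OF g]] .
    have "((\<lambda>s. g (y + s *\<^sub>R w)) has_derivative (\<lambda>r. partial (r *\<^sub>R w) g (y + s *\<^sub>R w))) (at s)"
      by (rule has_derivative_compose[OF _ partial_has_derivative[OF g]])
        (auto intro!: derivative_eq_intros)
    moreover have "(\<lambda>r. partial (r *\<^sub>R w) g (y + s *\<^sub>R w)) = (*) (partial w g (y + s *\<^sub>R w))"
      by (auto simp: D.scaleR)
    ultimately show ?thesis unfolding has_field_derivative_def by simp
  qed
  let ?\<phi> = "\<lambda>s. f ((x + t *\<^sub>R v) + s *\<^sub>R u) - f (x + s *\<^sub>R u)"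
  obtain \<xi> where \<xi>: "0 < \<xi>" "\<xi> < t" "?\<phi> t - ?\<phi> 0 = (t - 0) *
      (partial u f ((x + t *\<^sub>R v) + \<xi> *\<^sub>R u) - partial u f (x + \<xi> *\<^sub>R u))"
    using MVT2[OF t, of ?\<phi> "\<lambda>s. partial u f ((x + t *\<^sub>R v) + s *\<^sub>R u) - partial u f (x + s *\<^sub>R u)"]
      DERIV_diff[OF d[OF f(1)] d[OF f(1)]] by metis
  obtain \<eta> where \<eta>: "0 < \<eta>" "\<eta> < t" "partial u f ((x + \<xi> *\<^sub>R u) + t *\<^sub>R v) - partial u f ((x + \<xi> *\<^sub>R u) + 0 *\<^sub>R v)
      = (t - 0) * partial v (partial u f) ((x + \<xi> *\<^sub>R u) + \<eta> *\<^sub>R v)"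
    using MVT2[OF t, of "\<lambda>r. partial u f ((x + \<xi> *\<^sub>R u) + r *\<^sub>R v)"
        "\<lambda>r. partial v (partial u f) ((x + \<xi> *\<^sub>R u) + r *\<^sub>R v)"] d[OF f(2)] by metis
  have "f (x + t *\<^sub>R u + t *\<^sub>R v) - f (x + t *\<^sub>R u) - f (x + t *\<^sub>R v) + f x = ?\<phi> t - ?\<phi> 0"
    by (simp add: algebra_simps)
  also have "\<dots> = t * (partial u f ((x + \<xi> *\<^sub>R u) + t *\<^sub>R v) - partial u f ((x + \<xi> *\<^sub>R u) + 0 *\<^sub>R v))"
    unfolding \<xi>(3) by (simp add: algebra_simps)
  also have "\<dots> = t * (t * partial v (partial u f) (x + \<xi> *\<^sub>R u + \<eta> *\<^sub>R v))"
    unfolding \<eta>(3) by simp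
  finally show thesis using that \<xi>(1,2) \<eta>(1,2) by blast
qed

lemma partial_commute_real:
  fixes f :: "'a::euclidean_space \<Rightarrow> real"
  assumes f: "smooth_on UNIV f" and uv: "u \<in> Basis" "v \<in> Basis"
  shows "partial v (partial u f) x = partial u (partial v f) x"
proof (rule ccontr)
  let ?p = "partial v (partial u f)" and ?q = "partial u (partial v f)"
  assume "?p x \<noteq> ?q x"
  define e where "e = \<bar>?p x - ?q x\<bar> / 2"
  have e: "e > 0" using \<open>?p x \<noteq> ?q x\<close> by (simp add: e_def)
  have cont: "continuous_on UNIV ?p" "continuous_on UNIV ?q"
    using f uv by (auto intro!: smooth_on_continuous_on smooth_on_partial)
  obtain d1 where d1: "d1 > 0" "\<And>y. dist y x < d1 \<Longrightarrow> dist (?p y) (?p x) < e"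
    using cont(1) e unfolding continuous_on_iff by (metis UNIV_I)
  obtain d2 where d2: "d2 > 0" "\<And>y. dist y x < d2 \<Longrightarrow> dist (?q y) (?q x) < e"
    using cont(2) e unfolding continuous_on_iff by (metis UNIV_I)
  define t where "t = min d1 d2 / 2"
  have t: "t > 0" "2 * t \<le> d1" "2 * t \<le> d2" using d1 d2 by (auto simp: t_def)
  have diff: "g differentiable (at y)" if "smooth_on UNIV g" for g :: "'a \<Rightarrow> real" and y
    using smooth_on_differentiable[OF that] by simp
  have near: "dist (x + a *\<^sub>R w + b *\<^sub>R z) x < 2 * t"
    if "0 < a" "a < t" "0 < b" "b < t" "w \<in> Basis" "z \<in> Basis" for a b and w z :: 'a
  proof -
    have "dist (x + a *\<^sub>R w + b *\<^sub>R z) x = norm (a *\<^sub>R w + b *\<^sub>R z)" by (simp add: dist_norm)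
    also have "\<dots> \<le> norm (a *\<^sub>R w) + norm (b *\<^sub>R z)" by (rule norm_triangle_ineq)
    also have "\<dots> = a + b" using that by simp
    finally show ?thesis using that by simp
  qed
  obtain \<xi> \<eta> where 1: "0 < \<xi>" "\<xi> < t" "0 < \<eta>" "\<eta> < t"
    "f (x + t *\<^sub>R u + t *\<^sub>R v) - f (x + t *\<^sub>R u) - f (x + t *\<^sub>R v) + f x
      = t * (t * ?p (x + \<xi> *\<^sub>R u + \<eta> *\<^sub>R v))"
    using second_difference[OF diff diff t(1), OF f smooth_on_partial[OF f uv(1)]] .
  obtain \<xi>' \<eta>' where 2: "0 < \<xi>'" "\<xi>' < t" "0 < \<eta>'" "\<eta>' < t"
    "f (x + t *\<^sub>R v + t *\<^sub>R u) - f (x + t *\<^sub>R v) - f (x + t *\<^sub>R u) + f x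
      = t * (t * ?q (x + \<xi>' *\<^sub>R v + \<eta>' *\<^sub>R u))"
    using second_difference[OF diff diff t(1), OF f smooth_on_partial[OF f uv(2)]] .
  have "t * (t * ?p (x + \<xi> *\<^sub>R u + \<eta> *\<^sub>R v)) = t * (t * ?q (x + \<xi>' *\<^sub>R v + \<eta>' *\<^sub>R u))"
    unfolding 1(5)[symmetric] 2(5)[symmetric] by (simp add: algebra_simps)
  then have "?p (x + \<xi> *\<^sub>R u + \<eta> *\<^sub>R v) = ?q (x + \<xi>' *\<^sub>R v + \<eta>' *\<^sub>R u)" using t by simp
  moreover have "dist (?p (x + \<xi> *\<^sub>R u + \<eta> *\<^sub>R v)) (?p x) < e"
    using d1(2) near[OF 1(1-4) uv] t by force
  moreover have "dist (?q (x + \<xi>' *\<^sub>R v + \<eta>' *\<^sub>R u)) (?q x) < e"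
    using d2(2) near[OF 2(1-4) uv(2,1)] t by force
  ultimately have "\<bar>?p x - ?q x\<bar> < 2 * e" unfolding dist_real_def by linarith
  then show False unfolding e_def by simp
qed

lemma partial_commute:
  fixes f :: "'a::euclidean_space \<Rightarrow> 'b::euclidean_space"
  assumes f: "smooth_on UNIV f" and uv: "u \<in> Basis" "v \<in> Basis"
  shows "partial v (partial u f) = partial u (partial v f)"
proof (rule ext, rule euclidean_eqI)
  fix x and b :: 'b assume "b \<in> Basis"
  have h: "bounded_linear (\<lambda>y. y \<bullet> b)" by (rule bounded_linear_inner_left)
  have "partial v (partial u f) x \<bullet> b = partial v (partial u (\<lambda>x. f x \<bullet> b)) x"
    using foldr_partial_bounded_linear[OF h open_UNIV f, of "[v, u]" x] uv by simp
  also have "\<dots> = partial u (partial v (\<lambda>x. f x \<bullet> b)) x"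
    by (rule partial_commute_real[OF smooth_on_bounded_linear[OF h open_UNIV f] uv])
  also have "\<dots> = partial u (partial v f) x \<bullet> b"
    using foldr_partial_bounded_linear[OF h open_UNIV f, of "[u, v]" x] uv by simp
  finally show "partial v (partial u f) x \<bullet> b = partial u (partial v f) x \<bullet> b" .
qed

lemma foldr_partial_commute:
  fixes f :: "'a::euclidean_space \<Rightarrow> 'b::euclidean_space"
  assumes "smooth_on UNIV f" "v \<in> Basis" "set vs \<subseteq> Basis"
  shows "foldr partial vs (partial v f) = partial v (foldr partial vs f)"
  using assms(3)
proof (induction vs)
  case (Cons u vs)
  then show ?case
    using partial_commute[OF smooth_on_foldr_partial[OF assms(1), of vs] assms(2), of u] by simp
qed simp

section \<open>Schwartz functions\<close>

lemma Basis_plane: "(Basis :: (real^2) set) = {axis 1 1, axis 2 1}"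
  by (auto simp: Basis_vec_def UNIV_2)

lemma schwartz_weight_foldr:
  "schwartz_weight k \<alpha>1 \<alpha>2 \<phi> x = bracket x ^ k *
    norm (foldr partial (replicate \<alpha>2 (axis 2 1) @ replicate \<alpha>1 (axis 1 1)) \<phi> x)"
  by (simp add: schwartz_weight_def foldr_replicate)

lemma bracket_pos: "0 < bracket x"
  unfolding bracket_def by (simp add: add_pos_nonneg)

lemma schwartz_weight_nonneg: "0 \<le> schwartz_weight k \<alpha>1 \<alpha>2 \<phi> x"
  unfolding schwartz_weight_def using bracket_pos[of x] by simp

lemma replicate_axis_subset: "set (replicate n (axis i 1) @ replicate m (axis j 1)) \<subseteq> (Basis :: (real^2) set)"
  by (auto simp: Basis_vec_def)

lemma schwartz_smooth: "\<phi> \<in> schwartz \<Longrightarrow> smooth_on UNIV \<phi>"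
  unfolding schwartz_def by simp

lemma schwartz_weight_add:
  assumes "\<phi> \<in> schwartz" "\<psi> \<in> schwartz"
  shows "schwartz_weight k \<alpha>1 \<alpha>2 (\<lambda>x. \<phi> x + \<psi> x) x \<le> schwartz_weight k \<alpha>1 \<alpha>2 \<phi> x + schwartz_weight k \<alpha>1 \<alpha>2 \<psi> x"
  unfolding schwartz_weight_foldr
    foldr_partial_add[OF open_UNIV schwartz_smooth[OF assms(1)] schwartz_smooth[OF assms(2)] replicate_axis_subset UNIV_I]
    distrib_left[symmetric]
  by (intro mult_left_mono norm_triangle_ineq) (simp add: bracket_pos less_imp_le)

lemma schwartz_weight_scale:
  assumes "\<phi> \<in> schwartz"
  shows "schwartz_weight k \<alpha>1 \<alpha>2 (\<lambda>x. c * \<phi> x) x = norm c * schwartz_weight k \<alpha>1 \<alpha>2 \<phi> x"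
  unfolding schwartz_weight_foldr
    foldr_partial_bounded_linear[OF bounded_linear_mult_right open_UNIV schwartz_smooth[OF assms(1)] replicate_axis_subset UNIV_I]
  by (simp add: norm_mult)

lemma schwartz_weight_cnj:
  assumes "\<phi> \<in> schwartz"
  shows "schwartz_weight k \<alpha>1 \<alpha>2 (\<lambda>x. cnj (\<phi> x)) x = schwartz_weight k \<alpha>1 \<alpha>2 \<phi> x"
  unfolding schwartz_weight_foldr
    foldr_partial_bounded_linear[OF bounded_linear_cnj open_UNIV schwartz_smooth[OF assms(1)] replicate_axis_subset UNIV_I]
  by simp

lemma schwartz_weight_bdd: "\<phi> \<in> schwartz \<Longrightarrow> bdd_above (range (schwartz_weight k \<alpha>1 \<alpha>2 \<phi>))"
  unfolding schwartz_def mem_Collect_eq by (elim conjE allE)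

lemma schwartzI:
  assumes "smooth_on UNIV \<phi>" "\<And>k \<alpha>1 \<alpha>2. \<exists>C. \<forall>x. schwartz_weight k \<alpha>1 \<alpha>2 \<phi> x \<le> C"
  shows "\<phi> \<in> schwartz"
  using assms unfolding schwartz_def bdd_above_def by auto

lemma schwartzE:
  assumes "\<phi> \<in> schwartz"
  obtains C where "\<And>x. schwartz_weight k \<alpha>1 \<alpha>2 \<phi> x \<le> C"
  using schwartz_weight_bdd[OF assms, of k \<alpha>1 \<alpha>2] unfolding bdd_above_def by auto

lemma schwartz_subspace: "function_subspace schwartz"
  unfolding function_subspace_def
proof (intro conjI ballI allI)
  show "(\<lambda>x. 0) \<in> schwartz"
    by (rule schwartzI)
      (auto simp: schwartz_weight_foldr foldr_partial_zero smooth_on_const simp del: foldr_append intro!: exI[of _ 0])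
next
  fix \<phi> \<psi> assume \<phi>: "\<phi> \<in> schwartz" and \<psi>: "\<psi> \<in> schwartz"
  show "(\<lambda>x. \<phi> x + \<psi> x) \<in> schwartz"
  proof (rule schwartzI)
    show "smooth_on UNIV (\<lambda>x. \<phi> x + \<psi> x)" using \<phi> \<psi> by (auto intro: smooth_on_add schwartz_smooth)
    fix k \<alpha>1 \<alpha>2
    obtain C where C: "\<And>x. schwartz_weight k \<alpha>1 \<alpha>2 \<phi> x \<le> C" using schwartzE[OF \<phi>] by blast
    obtain D where D: "\<And>x. schwartz_weight k \<alpha>1 \<alpha>2 \<psi> x \<le> D" using schwartzE[OF \<psi>] by blast
    have "schwartz_weight k \<alpha>1 \<alpha>2 (\<lambda>x. \<phi> x + \<psi> x) x \<le> C + D" for x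
      using schwartz_weight_add[OF \<phi> \<psi>, of k \<alpha>1 \<alpha>2 x] C[of x] D[of x] by linarith
    then show "\<exists>C. \<forall>x. schwartz_weight k \<alpha>1 \<alpha>2 (\<lambda>x. \<phi> x + \<psi> x) x \<le> C" by blast
  qed
next
  fix c \<phi> assume \<phi>: "\<phi> \<in> schwartz"
  show "(\<lambda>x. c * \<phi> x) \<in> schwartz"
  proof (rule schwartzI)
    show "smooth_on UNIV (\<lambda>x. c * \<phi> x)"
      using \<phi> by (auto intro: smooth_on_bounded_linear[OF bounded_linear_mult_right] schwartz_smooth)
    fix k \<alpha>1 \<alpha>2
    obtain C where "\<And>x. schwartz_weight k \<alpha>1 \<alpha>2 \<phi> x \<le> C" using schwartzE[OF \<phi>] by blast
    then show "\<exists>C. \<forall>x. schwartz_weight k \<alpha>1 \<alpha>2 (\<lambda>x. c * \<phi> x) x \<le> C"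
      unfolding schwartz_weight_scale[OF \<phi>] by (auto intro!: exI[of _ "norm c * C"] mult_left_mono)
  qed
qed

lemma schwartz_cnj:
  assumes \<phi>: "\<phi> \<in> schwartz"
  shows "(\<lambda>x. cnj (\<phi> x)) \<in> schwartz"
proof (rule schwartzI)
  show "smooth_on UNIV (\<lambda>x. cnj (\<phi> x))"
    using \<phi> by (auto intro: smooth_on_bounded_linear[OF bounded_linear_cnj] schwartz_smooth)
  show "\<exists>C. \<forall>x. schwartz_weight k \<alpha>1 \<alpha>2 (\<lambda>x. cnj (\<phi> x)) x \<le> C" for k \<alpha>1 \<alpha>2
    unfolding schwartz_weight_cnj[OF \<phi>] using schwartzE[OF \<phi>] by metis
qed

text \<open>The weights of \<^const>\<open>schwartz\<close> fix the order of differentiation, so commuting partial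
  derivatives are needed to differentiate within the space.\<close>

lemma schwartz_partial:
  assumes \<phi>: "\<phi> \<in> schwartz" and v: "v \<in> Basis"
  shows "partial v \<phi> \<in> schwartz"
proof (rule schwartzI)
  show "smooth_on UNIV (partial v \<phi>)" using \<phi> v by (auto intro: smooth_on_partial schwartz_smooth)
  fix k \<alpha>1 \<alpha>2
  consider "v = axis 1 1" | "v = axis 2 1" using v by (auto simp: Basis_plane)
  then have "schwartz_weight k \<alpha>1 \<alpha>2 (partial v \<phi>) = schwartz_weight k (Suc \<alpha>1) \<alpha>2 \<phi> \<or>
    schwartz_weight k \<alpha>1 \<alpha>2 (partial v \<phi>) = schwartz_weight k \<alpha>1 (Suc \<alpha>2) \<phi>"
  proof cases
    case 1
    then show ?thesis by (auto simp: schwartz_weight_def funpow_swap1)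
  next
    case 2
    have "foldr partial (replicate \<alpha>2 (axis 2 1) @ replicate \<alpha>1 (axis 1 1)) (partial v \<phi>)
      = partial v (foldr partial (replicate \<alpha>2 (axis 2 1) @ replicate \<alpha>1 (axis 1 1)) \<phi>)"
      by (rule foldr_partial_commute[OF schwartz_smooth[OF \<phi>] v replicate_axis_subset])
    then show ?thesis using 2 by (auto simp: schwartz_weight_foldr)
  qed
  then show "\<exists>C. \<forall>x. schwartz_weight k \<alpha>1 \<alpha>2 (partial v \<phi>) x \<le> C"
    using schwartzE[OF \<phi>] by metis
qed

section \<open>Integration\<close>

lemma integrable_inverse_1_plus_square_lborel: "integrable lborel (\<lambda>x::real. 1 / (1 + x\<^sup>2))"
  using integrable_inverse_1_plus_square by (simp add: set_integrable_def inverse_eq_divide)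

lemma integrable_inverse_norm_power:
  assumes "n \<ge> 2 * DIM('a)"
  shows "integrable lborel (\<lambda>x::'a::euclidean_space. 1 / (1 + norm x) ^ n)"
proof -
  define P where "P = (\<lambda>x::'a. \<Prod>i\<in>Basis. 1 / (1 + (x \<bullet> i)\<^sup>2))"
  have P0: "P x \<ge> 0" for x unfolding P_def by (intro prod_nonneg) auto
  have Pm[measurable]: "P \<in> borel_measurable borel" unfolding P_def by measurable
  have "integrable lborel P"
  proof (rule integrableI_bounded)
    have "(\<integral>\<^sup>+x. ennreal (norm (P x)) \<partial>lborel) = (\<integral>\<^sup>+(x::'a). (\<Prod>i\<in>Basis. ennreal (1 / (1 + (x \<bullet> i)\<^sup>2))) \<partial>lborel)"
      by (rule nn_integral_cong) (simp add: P0, simp add: P_def prod_ennreal)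
    also have "\<dots> = (\<Prod>i\<in>(Basis::'a set). \<integral>\<^sup>+t. ennreal (1 / (1 + t\<^sup>2)) \<partial>lborel)"
      by (rule nn_integral_lborel_prod[where f = "\<lambda>_ t. ennreal (1 / (1 + t\<^sup>2))"]) auto
    also have "\<dots> < \<infinity>"
    proof -
      have "(\<integral>\<^sup>+t. ennreal (1 / (1 + t\<^sup>2)) \<partial>lborel) < \<infinity>"
        using integrable_inverse_1_plus_square_lborel unfolding integrable_iff_bounded by simp
      then show ?thesis by (simp add: power_less_top_ennreal)
    qed
    finally show "(\<integral>\<^sup>+x. ennreal (norm (P x)) \<partial>lborel) < \<infinity>" .
  qed simp
  then show ?thesis
  proof (rule Bochner_Integration.integrable_bound)
    show "AE x in lborel. norm (1 / (1 + norm x) ^ n) \<le> norm (P x)"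
    proof (rule AE_I2)
      fix x :: 'a
      have "(\<Prod>i\<in>(Basis::'a set). 1 + (x \<bullet> i)\<^sup>2) \<le> (\<Prod>i\<in>(Basis::'a set). (1 + norm x)\<^sup>2)"
      proof (rule prod_mono)
        fix i :: 'a assume "i \<in> Basis"
        then have "(x \<bullet> i)\<^sup>2 \<le> (norm x)\<^sup>2" using Basis_le_norm[of i x] by (simp add: abs_le_square_iff[symmetric])
        then show "0 \<le> 1 + (x \<bullet> i)\<^sup>2 \<and> 1 + (x \<bullet> i)\<^sup>2 \<le> (1 + norm x)\<^sup>2"
          by (simp add: power2_sum add_increasing2)
      qed
      also have "\<dots> = (1 + norm x) ^ (2 * DIM('a))" by (simp add: power_mult)
      also have "\<dots> \<le> (1 + norm x) ^ n" using assms by (intro power_increasing) auto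
      finally have *: "(\<Prod>i\<in>(Basis::'a set). 1 + (x \<bullet> i)\<^sup>2) \<le> (1 + norm x) ^ n" .
      have "0 < (\<Prod>i\<in>(Basis::'a set). 1 + (x \<bullet> i)\<^sup>2)" by (intro prod_pos) (auto simp: add_pos_nonneg)
      then have "1 / (1 + norm x) ^ n \<le> 1 / (\<Prod>i\<in>(Basis::'a set). 1 + (x \<bullet> i)\<^sup>2)"
        using * by (intro divide_left_mono) (auto intro!: mult_pos_pos zero_less_power simp: add_pos_nonneg)
      then show "norm (1 / (1 + norm x) ^ n) \<le> norm (P x)"
        using P0[of x] by (simp add: P_def prod_dividef)
    qed
  qed measurable
qed

lemma integrable_norm_power_bound:
  fixes f :: "'a::euclidean_space \<Rightarrow> complex"
  assumes "f \<in> borel_measurable borel" "\<And>x. norm (f x) \<le> C / (1 + norm x) ^ n" "n \<ge> 2 * DIM('a)"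
  shows "integrable lborel f"
proof (rule Bochner_Integration.integrable_bound)
  show "integrable lborel (\<lambda>x::'a. C * (1 / (1 + norm x) ^ n))"
    by (intro integrable_mult_right integrable_inverse_norm_power assms(3))
  show "AE x in lborel. norm (f x) \<le> norm (C * (1 / (1 + norm x) ^ n))"
    using assms(2) by (auto intro!: AE_I2 order_trans[OF assms(2)] divide_right_mono)
qed (use assms in auto)

lemma has_derivative_lebesgue_integral:
  fixes G :: "'a::euclidean_space \<Rightarrow> 'c \<Rightarrow> 'b::{banach, second_countable_topology}"
  assumes int: "\<And>x. integrable M (G x)"
    and der: "\<And>x \<omega>. ((\<lambda>x. G x \<omega>) has_derivative D x \<omega>) (at x)"
    and bd: "\<And>x \<omega> v. norm (D x \<omega> v) \<le> w \<omega> * norm v"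
    and w: "integrable M w"
    and meas: "\<And>x v. (\<lambda>\<omega>. D x \<omega> v) \<in> borel_measurable M"
  shows "((\<lambda>x. \<integral>\<omega>. G x \<omega> \<partial>M) has_derivative (\<lambda>v. \<integral>\<omega>. D x \<omega> v \<partial>M)) (at x)"
proof -
  have lin: "bounded_linear (D x \<omega>)" for x \<omega> using has_derivative_bounded_linear[OF der] .
  have intD: "integrable M (\<lambda>\<omega>. D x \<omega> v)" for x v
    by (rule Bochner_Integration.integrable_bound[OF integrable_mult_left[OF w, of "norm v"] meas])
      (use bd in \<open>auto intro!: AE_I2 order_trans[OF _ abs_ge_self]\<close>)
  have lip: "norm (G y \<omega> - G x \<omega>) \<le> w \<omega> * norm (y - x)" for x y \<omega>
  proof (rule differentiable_bound[OF convex_UNIV])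
    show "((\<lambda>x. G x \<omega>) has_derivative D z \<omega>) (at z within UNIV)" for z by (rule der)
    obtain i :: 'a where "i \<in> Basis" using nonempty_Basis by blast
    then have "0 \<le> w \<omega>" using order_trans[OF norm_ge_zero bd[of x \<omega> i]] by simp
    then show "onorm (D z \<omega>) \<le> w \<omega>" for z by (intro onorm_bound bd)
  qed simp_all
  show ?thesis
    unfolding has_derivative_iff_norm
  proof
    show "bounded_linear (\<lambda>v. \<integral>\<omega>. D x \<omega> v \<partial>M)"
    proof (rule bounded_linear_intro)
      show "(\<integral>\<omega>. D x \<omega> (u + v) \<partial>M) = (\<integral>\<omega>. D x \<omega> u \<partial>M) + (\<integral>\<omega>. D x \<omega> v \<partial>M)" for u v
        by (subst Bochner_Integration.integral_add[symmetric, OF intD intD])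
          (simp add: bounded_linear.linear[OF lin, THEN linear_add])
      show "(\<integral>\<omega>. D x \<omega> (r *\<^sub>R v) \<partial>M) = r *\<^sub>R (\<integral>\<omega>. D x \<omega> v \<partial>M)" for r v
        by (subst integral_scaleR_right[symmetric])
          (simp add: bounded_linear.linear[OF lin, THEN linear_scale])
      have "norm (\<integral>\<omega>. D x \<omega> v \<partial>M) \<le> (\<integral>\<omega>. w \<omega> * norm v \<partial>M)" for v
        by (rule order_trans[OF integral_norm_bound Bochner_Integration.integral_mono]) (use intD w bd in auto)
      then show "norm (\<integral>\<omega>. D x \<omega> v \<partial>M) \<le> norm v * (\<integral>\<omega>. w \<omega> \<partial>M)" for v
        by (simp add: mult.commute)
    qed
    let ?R = "\<lambda>y \<omega>. G y \<omega> - G x \<omega> - D x \<omega> (y - x)"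
    have intR: "integrable M (?R y)" for y by (intro Bochner_Integration.integrable_diff int intD)
    have Rbd: "norm (?R y \<omega>) / norm (y - x) \<le> 2 * w \<omega>" if "y \<noteq> x" for y \<omega>
    proof -
      have "norm (?R y \<omega>) \<le> norm (G y \<omega> - G x \<omega>) + norm (D x \<omega> (y - x))" by (rule norm_triangle_ineq4)
      also have "\<dots> \<le> 2 * w \<omega> * norm (y - x)" using lip[of y \<omega> x] bd[of x \<omega> "y - x"] by linarith
      finally show ?thesis using that by (simp add: divide_le_eq)
    qed
    have eq: "(\<integral>\<omega>. G y \<omega> \<partial>M) - (\<integral>\<omega>. G x \<omega> \<partial>M) - (\<integral>\<omega>. D x \<omega> (y - x) \<partial>M) = (\<integral>\<omega>. ?R y \<omega> \<partial>M)" for y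
      by (simp add: int intD)
    show "((\<lambda>y. norm ((\<integral>\<omega>. G y \<omega> \<partial>M) - (\<integral>\<omega>. G x \<omega> \<partial>M) - (\<integral>\<omega>. D x \<omega> (y - x) \<partial>M)) / norm (y - x)) \<longlongrightarrow> 0) (at x)"
      unfolding eq tendsto_at_iff_sequentially
    proof (intro allI impI)
      fix X :: "nat \<Rightarrow> 'a" assume X: "\<forall>i. X i \<in> UNIV - {x}" "X \<longlonglongrightarrow> x"
      have "(\<lambda>n. \<integral>\<omega>. norm (?R (X n) \<omega>) / norm (X n - x) \<partial>M) \<longlonglongrightarrow> (\<integral>\<omega>. 0 \<partial>M)"
      proof (rule integral_dominated_convergence[where w = "\<lambda>\<omega>. 2 * w \<omega>"])
        show "(\<lambda>\<omega>. norm (?R (X i) \<omega>) / norm (X i - x)) \<in> borel_measurable M" for i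
          using borel_measurable_integrable[OF intR[of "X i"]] by measurable
        show "AE \<omega> in M. (\<lambda>i. norm (?R (X i) \<omega>) / norm (X i - x)) \<longlonglongrightarrow> 0"
        proof (rule AE_I2)
          fix \<omega>
          have "((\<lambda>y. norm (?R y \<omega>) / norm (y - x)) \<longlongrightarrow> 0) (at x)"
            using der[of \<omega> x] unfolding has_derivative_iff_norm by blast
          then show "(\<lambda>i. norm (?R (X i) \<omega>) / norm (X i - x)) \<longlonglongrightarrow> 0"
            using X unfolding tendsto_at_iff_sequentially comp_def by blast
        qed
        show "AE \<omega> in M. norm (norm (?R (X i) \<omega>) / norm (X i - x)) \<le> 2 * w \<omega>" for i
          using Rbd X(1) by (auto intro!: AE_I2)
      qed (use w in auto)
      then have lim: "(\<lambda>n. \<integral>\<omega>. norm (?R (X n) \<omega>) / norm (X n - x) \<partial>M) \<longlonglongrightarrow> 0" by simp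
      show "((\<lambda>y. norm (\<integral>\<omega>. ?R y \<omega> \<partial>M) / norm (y - x)) \<circ> X) \<longlonglongrightarrow> 0"
      proof (rule Lim_null_comparison[OF _ lim], intro always_eventually allI)
        fix n
        have "norm (\<integral>\<omega>. ?R (X n) \<omega> \<partial>M) \<le> (\<integral>\<omega>. norm (?R (X n) \<omega>) \<partial>M)" by (rule integral_norm_bound)
        then show "norm (((\<lambda>y. norm (\<integral>\<omega>. ?R y \<omega> \<partial>M) / norm (y - x)) \<circ> X) n)
            \<le> (\<integral>\<omega>. norm (?R (X n) \<omega>) / norm (X n - x) \<partial>M)"
          by (simp add: divide_right_mono)
      qed
    qed
  qed
qed

section \<open>The shearlet coordinates\<close>

type_synonym shearlet_param = "real \<times> real \<times> (real^2)"

definition shear_coord :: "shearlet_param \<Rightarrow> real^2 \<Rightarrow> real^2"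
  where "shear_coord \<omega> y =
    ((y$1 + fst (snd \<omega>) * y$2) / fst \<omega>) *\<^sub>R axis 1 1 + (sqrt \<bar>fst \<omega>\<bar> / fst \<omega> * y$2) *\<^sub>R axis 2 1"

lemma shear_coord_nth [simp]:
  "shear_coord \<omega> y $ 1 = (y$1 + fst (snd \<omega>) * y$2) / fst \<omega>"
  "shear_coord \<omega> y $ 2 = sqrt \<bar>fst \<omega>\<bar> / fst \<omega> * y$2"
  by (simp_all add: shear_coord_def axis_def)

lemma matrix_inv_vector_mult:
  fixes A :: "real^'n^'n"
  assumes "invertible A"
  shows "matrix_inv A *v (A *v x) = x"
  proof -
  have "matrix_inv A ** A = mat 1"
    using someI_ex[OF assms[unfolded invertible_def]] unfolding matrix_inv_def by blast
  then show ?thesis by (simp add: matrix_vector_mul_assoc)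
qed

lemma shearlet_rep_coord:
  assumes "a \<noteq> 0"
  shows "shearlet_rep b s a \<psi> x = complex_of_real (\<bar>a\<bar> powr (- 3 / 4)) * \<psi> (shear_coord (a, s, b) (x - b))"
proof -
  define z where "z = shear_coord (a, s, b) (x - b)"
  have pos: "\<bar>a\<bar> powr (1 / 2) = sqrt \<bar>a\<bar>" "\<bar>a\<bar> powr (- 1 / 2) = 1 / sqrt \<bar>a\<bar>" "sqrt \<bar>a\<bar> > 0"
    using assms powr_minus[of "\<bar>a\<bar>" "1/2"] by (auto simp: powr_half_sqrt inverse_eq_divide)
  define q where "q = sqrt \<bar>a\<bar>"
  have q: "q > 0" "\<bar>a\<bar> powr (- 1 / 2) = 1 / q" using pos by (auto simp: q_def)
  have eq: "x - b = shear_matrix s *v (dilation_matrix a *v z)"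
    using assms q(1)
    by (simp add: vec_eq_iff forall_2 shear_matrix_def dilation_matrix_def matrix_vector_mult_def
        sum_2 vector_2 z_def q(2)[unfolded minus_divide_left[symmetric]] q_def[symmetric])
  have inv: "invertible (shear_matrix s)" "invertible (dilation_matrix a)"
    using pos assms
    by (simp_all add: invertible_det_nz det_2 shear_matrix_def dilation_matrix_def vector_2)
  have "matrix_inv (dilation_matrix a) *v (matrix_inv (shear_matrix s) *v (x - b)) = z"
    unfolding eq by (simp add: matrix_inv_vector_mult inv)
  then show ?thesis unfolding shearlet_rep_def z_def by simp
qed

lemma linear_shear_coord: "linear (shear_coord \<omega>)"
  by (rule linearI) (simp_all add: vec_eq_iff forall_2 add_divide_distrib algebra_simps)

lemma shear_coord_diff: "shear_coord \<omega> (x - y) = shear_coord \<omega> x - shear_coord \<omega> y"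
  by (rule linear_diff[OF linear_shear_coord])

lemma borel_measurable_fst_snd [measurable]:
  "(fst :: 'a::second_countable_topology \<times> 'b::second_countable_topology \<Rightarrow> 'a) \<in> borel_measurable borel"
  "(snd :: 'a \<times> 'b \<Rightarrow> 'b) \<in> borel_measurable borel"
  unfolding borel_prod[symmetric] by simp_all

lemma borel_measurable_vec_component [measurable (raw)]:
  "f \<in> borel_measurable M \<Longrightarrow> (\<lambda>x. (f x :: real^'n) $ i) \<in> borel_measurable M"
  by (rule measurable_compose[OF _ borel_measurable_nth])

lemma borel_measurable_shear_coord [measurable (raw)]:
  assumes "f \<in> borel_measurable M" "g \<in> borel_measurable M"
  shows "(\<lambda>x. shear_coord (f x) (g x)) \<in> borel_measurable M"
proof -
  have [measurable]: "(\<lambda>x. fst (f x)) \<in> borel_measurable M" "(\<lambda>x. fst (snd (f x))) \<in> borel_measurable M"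
    using assms(1) by measurable
  note assms(2)[measurable]
  show ?thesis unfolding shear_coord_def by measurable
qed

definition param_weight :: "shearlet_param \<Rightarrow> real"
  where "param_weight \<omega> = (1 + norm \<omega>) * (1 + 1 / \<bar>fst \<omega>\<bar>)"

lemma param_norm_le:
  fixes \<omega> :: shearlet_param
  shows "\<bar>fst \<omega>\<bar> \<le> norm \<omega>" "\<bar>fst (snd \<omega>)\<bar> \<le> norm \<omega>" "norm (snd (snd \<omega>)) \<le> norm \<omega>"
  using norm_fst_le[of "fst \<omega>" "snd \<omega>"] norm_snd_le[of "snd \<omega>" "fst \<omega>"]
    norm_fst_le[of "fst (snd \<omega>)" "snd (snd \<omega>)"] norm_snd_le[of "snd (snd \<omega>)" "fst (snd \<omega>)"]
  by (simp_all; linarith)+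

lemma param_weight_ge:
  "1 \<le> param_weight \<omega>" "1 + norm \<omega> \<le> param_weight \<omega>" "1 + 1 / \<bar>fst \<omega>\<bar> \<le> param_weight \<omega>"
proof -
  show 2: "1 + norm \<omega> \<le> param_weight \<omega>"
    unfolding param_weight_def using mult_left_mono[of 1 "1 + 1 / \<bar>fst \<omega>\<bar>" "1 + norm \<omega>"] by simp
  show "1 \<le> param_weight \<omega>" using 2 norm_ge_zero[of \<omega>] by linarith
  show "1 + 1 / \<bar>fst \<omega>\<bar> \<le> param_weight \<omega>"
    unfolding param_weight_def using mult_right_mono[of 1 "1 + norm \<omega>" "1 + 1 / \<bar>fst \<omega>\<bar>"] by simp
qed

lemma sqrt_le_1_plus: "0 \<le> t \<Longrightarrow> sqrt t \<le> 1 + t"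
  by (rule real_le_lsqrt) (auto simp: power2_eq_square algebra_simps)

lemma norm_shear_coord_le: "norm (shear_coord \<omega> v) \<le> 2 * param_weight \<omega> * norm v"
proof (cases "fst \<omega> = 0")
  case True
  then have "shear_coord \<omega> v = 0" by (simp add: shear_coord_def)
  then show ?thesis using param_weight_ge(1)[of \<omega>] by simp
next
  case False
  have v: "\<bar>v$1\<bar> \<le> norm v" "\<bar>v$2\<bar> \<le> norm v" using component_le_norm_cart by auto
  define i where "i = 1 / \<bar>fst \<omega>\<bar>"
  have "\<bar>shear_coord \<omega> v $ 1\<bar> \<le> (\<bar>v$1\<bar> + \<bar>fst (snd \<omega>)\<bar> * \<bar>v$2\<bar>) * i"
    by (simp add: abs_mult[symmetric] divide_right_mono i_def)
  also have "\<dots> \<le> (norm v + norm \<omega> * norm v) * (1 + i)"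
    by (intro mult_mono add_mono v param_norm_le) (auto simp: i_def)
  also have "\<dots> = param_weight \<omega> * norm v" by (simp add: param_weight_def i_def[symmetric] algebra_simps)
  finally have 1: "\<bar>shear_coord \<omega> v $ 1\<bar> \<le> param_weight \<omega> * norm v" .
  have "sqrt \<bar>fst \<omega>\<bar> * i = sqrt i"
    using False by (simp add: i_def real_sqrt_divide field_simps)
  also have "\<dots> \<le> 1 + i" by (rule sqrt_le_1_plus) (simp add: i_def)
  finally have "sqrt \<bar>fst \<omega>\<bar> * i \<le> param_weight \<omega>" using param_weight_ge(3)[of \<omega>] unfolding i_def by linarith
  moreover have "\<bar>shear_coord \<omega> v $ 2\<bar> = (sqrt \<bar>fst \<omega>\<bar> * i) * \<bar>v$2\<bar>" by (simp add: abs_mult i_def)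
  ultimately have 2: "\<bar>shear_coord \<omega> v $ 2\<bar> \<le> param_weight \<omega> * norm v"
    using v(2) param_weight_ge(1)[of \<omega>] by (simp only:) (intro mult_mono, auto)
  show ?thesis
    using norm_le_l1_cart[of "shear_coord \<omega> v"] 1 2 by (simp add: sum_2 del: shear_coord_nth)
qed

lemma norm_le_shear_coord:
  assumes "fst \<omega> \<noteq> 0"
  shows "norm y \<le> 2 * param_weight \<omega> ^ 2 * norm (shear_coord \<omega> y)"
proof -
  define z where "z = shear_coord \<omega> y"
  let ?W = "param_weight \<omega>"
  have z: "\<bar>z$1\<bar> \<le> norm z" "\<bar>z$2\<bar> \<le> norm z" using component_le_norm_cart by auto
  have W: "1 \<le> ?W" "\<bar>fst \<omega>\<bar> \<le> ?W - 1" "\<bar>fst (snd \<omega>)\<bar> \<le> ?W - 1" "sqrt \<bar>fst \<omega>\<bar> \<le> ?W"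
    using param_weight_ge[of \<omega>] param_norm_le[of \<omega>] sqrt_le_1_plus[of "\<bar>fst \<omega>\<bar>"] by auto
  have y2: "y$2 = fst \<omega> / sqrt \<bar>fst \<omega>\<bar> * z$2" using assms by (simp add: z_def)
  have "fst \<omega> / sqrt \<bar>fst \<omega>\<bar> = sgn (fst \<omega>) * sqrt \<bar>fst \<omega>\<bar>"
    using assms by (simp add: field_simps sgn_if)
  then have y2: "\<bar>y$2\<bar> = sqrt \<bar>fst \<omega>\<bar> * \<bar>z$2\<bar>" using assms by (simp add: y2 abs_mult)
  have "sqrt \<bar>fst \<omega>\<bar> * \<bar>z$2\<bar> \<le> ?W * norm z" using W z by (intro mult_mono) auto
  then have y2': "\<bar>y$2\<bar> \<le> ?W * norm z" using y2 by simp
  have "y$1 = fst \<omega> * z$1 - fst (snd \<omega>) * y$2" using assms by (simp add: z_def)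
  then have "\<bar>y$1\<bar> \<le> \<bar>fst \<omega>\<bar> * \<bar>z$1\<bar> + \<bar>fst (snd \<omega>)\<bar> * \<bar>y$2\<bar>"
    by (metis abs_mult abs_triangle_ineq4)
  also have "\<dots> \<le> ?W * norm z + (?W - 1) * (?W * norm z)"
    using W z y2' by (intro add_mono mult_mono) auto
  also have "\<dots> = ?W ^ 2 * norm z" by (simp add: power2_eq_square algebra_simps)
  finally have 1: "\<bar>y$1\<bar> \<le> ?W ^ 2 * norm z" .
  have "?W * norm z \<le> ?W ^ 2 * norm z"
    using W(1) by (intro mult_right_mono) (auto simp: power2_eq_square)
  then show ?thesis
    using norm_le_l1_cart[of y] 1 y2' by (simp add: sum_2 z_def)
qed

lemma norm_le_shear_coord_translate:
  assumes "fst \<omega> \<noteq> 0"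
  shows "1 + norm x \<le> 3 * param_weight \<omega> ^ 2 * (1 + norm (shear_coord \<omega> (x - snd (snd \<omega>))))"
proof -
  let ?W = "param_weight \<omega>" and ?z = "shear_coord \<omega> (x - snd (snd \<omega>))"
  have "norm x \<le> norm (x - snd (snd \<omega>)) + norm (snd (snd \<omega>))"
    by (metis diff_add_cancel norm_triangle_ineq)
  then have 1: "1 + norm x \<le> ?W + 2 * ?W ^ 2 * norm ?z"
    using norm_le_shear_coord[OF assms, of "x - snd (snd \<omega>)"] param_weight_ge(2)[of \<omega>] param_norm_le(3)[of \<omega>]
    by linarith
  have "?W \<le> ?W ^ 2" using param_weight_ge(1)[of \<omega>] by (simp add: power2_eq_square)
  moreover have "0 \<le> ?W ^ 2 * norm ?z" "0 \<le> ?W ^ 2" by simp_all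
  moreover have "3 * ?W ^ 2 * (1 + norm ?z) = 3 * ?W ^ 2 + 3 * (?W ^ 2 * norm ?z)"
    by (simp add: algebra_simps)
  ultimately show ?thesis using 1 by linarith
qed

lemma one_plus_norm_le_bracket: "1 + norm x \<le> 2 * bracket x"
proof -
  have "(1 + norm x)\<^sup>2 \<le> (2 * bracket x)\<^sup>2"
    using sum_squares_bound[of 1 "norm x"]
    unfolding bracket_def power_mult_distrib power2_sum by simp (use zero_le_power2[of "norm x"] in linarith)
  then show ?thesis by (rule power2_le_imp_le) (simp add: bracket_pos less_imp_le)
qed

lemma bracket_le_one_plus_norm: "bracket x \<le> 1 + norm x"
  unfolding bracket_def by (rule real_le_lsqrt) (auto simp: power2_sum)

lemma schwartz_norm_power_bound:
  assumes "\<psi> \<in> schwartz"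
  obtains C where "C \<ge> 0" "\<And>x. (1 + norm x) ^ k * norm (\<psi> x) \<le> C"
proof -
  obtain C where C: "\<And>x. schwartz_weight k 0 0 \<psi> x \<le> C" using schwartzE[OF assms] by blast
  have "(1 + norm x) ^ k * norm (\<psi> x) \<le> 2 ^ k * C" for x
  proof -
    have "(1 + norm x) ^ k * norm (\<psi> x) \<le> (2 * bracket x) ^ k * norm (\<psi> x)"
      by (intro mult_right_mono power_mono one_plus_norm_le_bracket) auto
    also have "\<dots> = 2 ^ k * schwartz_weight k 0 0 \<psi> x"
      by (simp add: schwartz_weight_def power_mult_distrib)
    also have "\<dots> \<le> 2 ^ k * C" by (intro mult_left_mono C) auto
    finally show ?thesis .
  qed
  moreover have "0 \<le> 2 ^ k * C" using schwartz_weight_nonneg[of k 0 0 \<psi> 0] C[of 0] by simp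
  ultimately show thesis using that by blast
qed

lemma schwartz_borel_measurable: "\<psi> \<in> schwartz \<Longrightarrow> \<psi> \<in> borel_measurable borel"
  using smooth_on_continuous_on[OF schwartz_smooth] by (rule borel_measurable_continuous_onI)

section \<open>Superpositions of shearlets\<close>

definition rapid :: "(shearlet_param \<Rightarrow> complex) \<Rightarrow> bool"
  where "rapid F \<longleftrightarrow> F \<in> borel_measurable borel \<and> (\<forall>\<omega>. fst \<omega> = 0 \<longrightarrow> F \<omega> = 0) \<and>
    (\<forall>n. \<exists>B. \<forall>\<omega>. param_weight \<omega> ^ n * norm (F \<omega>) \<le> B)"

definition shearlet_kernel :: "(real^2 \<Rightarrow> complex) \<Rightarrow> (shearlet_param \<Rightarrow> complex) \<Rightarrow> real^2 \<Rightarrow> shearlet_param \<Rightarrow> complex"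
  where "shearlet_kernel \<psi> F x \<omega> = F \<omega> * \<psi> (shear_coord \<omega> (x - snd (snd \<omega>)))"

definition superpose :: "(real^2 \<Rightarrow> complex) \<Rightarrow> (shearlet_param \<Rightarrow> complex) \<Rightarrow> real^2 \<Rightarrow> complex"
  where "superpose \<psi> F x = (\<integral>\<omega>. shearlet_kernel \<psi> F x \<omega> \<partial>lborel)"

lemma rapidD:
  assumes "rapid F"
  shows "F \<in> borel_measurable borel" "fst \<omega> = 0 \<Longrightarrow> F \<omega> = 0"
  using assms[unfolded rapid_def, THEN conjunct1]
    assms[unfolded rapid_def, THEN conjunct2, THEN conjunct1, THEN spec, THEN mp] by this

lemma rapidE:
  assumes "rapid F"
  obtains B where "B \<ge> 0" "\<And>\<omega>. param_weight \<omega> ^ n * norm (F \<omega>) \<le> B"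
proof -
  obtain B where B: "\<forall>\<omega>. param_weight \<omega> ^ n * norm (F \<omega>) \<le> B"
    using assms[unfolded rapid_def, THEN conjunct2, THEN conjunct2, THEN spec, of n] by (elim exE)
  have "0 \<le> param_weight 0 ^ n * norm (F 0)"
    using param_weight_ge(1)[of 0] by (intro mult_nonneg_nonneg zero_le_power) auto
  then have "0 \<le> B" using B[rule_format, of 0] by (rule order_trans)
  then show thesis using B by (intro that) auto
qed

lemma shearlet_kernel_bound:
  assumes \<psi>: "\<psi> \<in> schwartz"
  shows "\<exists>C\<ge>0. \<forall>F B x \<omega>. rapid F \<longrightarrow>
      (\<forall>\<omega>. param_weight \<omega> ^ (2 * k + j) * norm (F \<omega>) \<le> B) \<longrightarrow>
      (1 + norm x) ^ k * norm (shearlet_kernel \<psi> F x \<omega>) \<le> C * B / (1 + norm \<omega>) ^ j"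
proof -
  obtain C where C: "C \<ge> 0" "\<And>z. (1 + norm z) ^ k * norm (\<psi> z) \<le> C"
    using schwartz_norm_power_bound[OF \<psi>] by blast
  have "(1 + norm x) ^ k * norm (shearlet_kernel \<psi> F x \<omega>) \<le> (3 ^ k * C) * B / (1 + norm \<omega>) ^ j"
    if F: "rapid F"
      and B: "\<And>\<omega>. param_weight \<omega> ^ (2 * k + j) * norm (F \<omega>) \<le> B" for F B x \<omega>
  proof (cases "fst \<omega> = 0")
    case True
    have "0 \<le> param_weight \<omega> ^ (2 * k + j) * norm (F \<omega>)"
      using param_weight_ge(1)[of \<omega>] by (intro mult_nonneg_nonneg zero_le_power) auto
    then have "0 \<le> B" using B[of \<omega>] by linarith
    then show ?thesis using rapidD(2)[OF F True] C(1) by (simp add: shearlet_kernel_def)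
  next
    case False
    let ?W = "param_weight \<omega>" and ?z = "shear_coord \<omega> (x - snd (snd \<omega>))"
    have W: "1 \<le> ?W" by (rule param_weight_ge)
    have "(1 + norm x) ^ k \<le> (3 * ?W ^ 2 * (1 + norm ?z)) ^ k"
      by (intro power_mono norm_le_shear_coord_translate False) auto
    also have "\<dots> = 3 ^ k * ?W ^ (2 * k) * (1 + norm ?z) ^ k"
      by (simp add: power_mult_distrib power_mult)
    finally have "(1 + norm x) ^ k * norm (shearlet_kernel \<psi> F x \<omega>)
        \<le> 3 ^ k * ?W ^ (2 * k) * (1 + norm ?z) ^ k * norm (shearlet_kernel \<psi> F x \<omega>)"
      by (rule mult_right_mono) simp
    also have "\<dots> = 3 ^ k * (?W ^ (2 * k) * norm (F \<omega>)) * ((1 + norm ?z) ^ k * norm (\<psi> ?z))"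
      by (simp add: shearlet_kernel_def norm_mult mult_ac)
    also have "\<dots> \<le> 3 ^ k * (B / (1 + norm \<omega>) ^ j) * C"
    proof (intro mult_mono C(2))
      have "?W ^ (2 * k) * norm (F \<omega>) * (1 + norm \<omega>) ^ j \<le> ?W ^ (2 * k) * norm (F \<omega>) * ?W ^ j"
        using W param_weight_ge(2)[of \<omega>] by (intro mult_left_mono power_mono) auto
      also have "\<dots> \<le> B" using B[of \<omega>] by (simp add: power_add mult_ac)
      finally show le: "?W ^ (2 * k) * norm (F \<omega>) \<le> B / (1 + norm \<omega>) ^ j"
        by (simp add: pos_le_divide_eq add_pos_nonneg)
      have "0 \<le> ?W ^ (2 * k) * norm (F \<omega>)" using W by simp
      then show "0 \<le> 3 ^ k * (B / (1 + norm \<omega>) ^ j)" using order_trans[OF _ le] by (intro mult_nonneg_nonneg[of "3 ^ k"]) auto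
    qed (use W in auto)
    finally show ?thesis by (simp add: mult_ac)
  qed
  then show ?thesis using C(1) by (intro exI[of _ "3 ^ k * C"]) auto
qed

lemma borel_measurable_shearlet_kernel [measurable (raw)]:
  assumes [measurable]: "\<psi> \<in> borel_measurable borel" "F \<in> borel_measurable borel"
    "f \<in> borel_measurable M" "g \<in> borel_measurable M"
  shows "(\<lambda>y. shearlet_kernel \<psi> F (f y) (g y)) \<in> borel_measurable M"
  unfolding shearlet_kernel_def by measurable

lemma integrable_shearlet_kernel:
  assumes \<psi>: "\<psi> \<in> schwartz" and F: "rapid F"
  shows "integrable lborel (shearlet_kernel \<psi> F x)"
proof -
  obtain C where C: "\<forall>F B x \<omega>. rapid F \<longrightarrow>
      (\<forall>\<omega>. param_weight \<omega> ^ (2 * 0 + 8) * norm (F \<omega>) \<le> B) \<longrightarrow>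
      (1 + norm x) ^ 0 * norm (shearlet_kernel \<psi> F x \<omega>) \<le> C * B / (1 + norm \<omega>) ^ 8"
    using shearlet_kernel_bound[OF \<psi>, of 0 8] by (elim exE conjE)
  obtain B where B: "\<And>\<omega>. param_weight \<omega> ^ (2 * 0 + 8) * norm (F \<omega>) \<le> B" using rapidE[OF F] by blast
  note [measurable] = schwartz_borel_measurable[OF \<psi>] rapidD(1)[OF F]
  have "(\<lambda>\<omega>. shearlet_kernel \<psi> F x \<omega>) \<in> borel_measurable borel" by measurable
  then show ?thesis
  proof (rule integrable_norm_power_bound)
    show "norm (shearlet_kernel \<psi> F x \<omega>) \<le> C * B / (1 + norm \<omega>) ^ 8" for \<omega>
      using C[rule_format, OF F B, of x \<omega>] by simp
  qed simp
qed

definition coord_mult :: "real^2 \<Rightarrow> real^2 \<Rightarrow> (shearlet_param \<Rightarrow> complex) \<Rightarrow> shearlet_param \<Rightarrow> complex"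
  where "coord_mult i v F \<omega> = complex_of_real (shear_coord \<omega> v \<bullet> i) * F \<omega>"

lemma coord_mult_bound:
  assumes "norm i = 1" "norm v = 1" "param_weight \<omega> ^ Suc n * norm (F \<omega>) \<le> B"
  shows "param_weight \<omega> ^ n * norm (coord_mult i v F \<omega>) \<le> 2 * B"
proof -
  have W: "0 \<le> param_weight \<omega>" using param_weight_ge(1)[of \<omega>] by linarith
  have "norm (coord_mult i v F \<omega>) \<le> 2 * param_weight \<omega> * norm (F \<omega>)"
  proof -
    have "\<bar>shear_coord \<omega> v \<bullet> i\<bar> \<le> norm (shear_coord \<omega> v)"
      using Cauchy_Schwarz_ineq2[of "shear_coord \<omega> v" i] unfolding assms(1) by simp
    also have "\<dots> \<le> 2 * param_weight \<omega>"
      using norm_shear_coord_le[of \<omega> v] unfolding assms(2) by simp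
    finally show ?thesis
      unfolding coord_mult_def norm_mult norm_of_real by (rule mult_right_mono) simp
  qed
  then have "param_weight \<omega> ^ n * norm (coord_mult i v F \<omega>) \<le> param_weight \<omega> ^ n * (2 * param_weight \<omega> * norm (F \<omega>))"
    using W by (intro mult_left_mono) auto
  also have "\<dots> = 2 * (param_weight \<omega> ^ Suc n * norm (F \<omega>))" by simp
  finally show ?thesis using assms(3) by linarith
qed

lemma rapid_coord_mult:
  assumes "norm i = 1" "norm v = 1" and F: "rapid F"
  shows "rapid (coord_mult i v F)"
  unfolding rapid_def
proof (intro conjI allI impI)
  note [measurable] = rapidD(1)[OF F]
  show "coord_mult i v F \<in> borel_measurable borel" unfolding coord_mult_def by measurable
  show "coord_mult i v F \<omega> = 0" if "fst \<omega> = 0" for \<omega> using rapidD(2)[OF F that] by (simp add: coord_mult_def)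
  fix n
  obtain B where B: "\<And>\<omega>. param_weight \<omega> ^ Suc n * norm (F \<omega>) \<le> B"
    using rapidE[OF F, of "Suc n"] by blast
  then show "\<exists>B. \<forall>\<omega>. param_weight \<omega> ^ n * norm (coord_mult i v F \<omega>) \<le> B"
    by (intro exI[of _ "2 * B"] allI coord_mult_bound assms(1,2))
qed

lemma partial_plane:
  fixes \<psi> :: "real^2 \<Rightarrow> complex"
  assumes "\<psi> differentiable (at z)"
  shows "partial u \<psi> z = complex_of_real (u $ 1) * partial (axis 1 1) \<psi> z
    + complex_of_real (u $ 2) * partial (axis 2 1) \<psi> z"
proof -
  note lin = bounded_linear.linear[OF has_derivative_bounded_linear[OF partial_has_derivative[OF assms]]]
  have "u = u $ 1 *\<^sub>R axis 1 1 + u $ 2 *\<^sub>R axis 2 1" by (simp add: vec_eq_iff forall_2 axis_def)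
  then have "partial u \<psi> z = partial (u $ 1 *\<^sub>R axis 1 1 + u $ 2 *\<^sub>R axis 2 1) \<psi> z" by simp
  also have "\<dots> = u $ 1 *\<^sub>R partial (axis 1 1) \<psi> z + u $ 2 *\<^sub>R partial (axis 2 1) \<psi> z"
    using linear_add[OF lin] linear_scale[OF lin] by simp
  finally show ?thesis by (simp add: scaleR_conv_of_real)
qed

lemma superpose_has_derivative:
  assumes \<psi>: "\<psi> \<in> schwartz" and F: "rapid F"
  shows "(superpose \<psi> F has_derivative
    (\<lambda>v. \<integral>\<omega>. F \<omega> * partial (shear_coord \<omega> v) \<psi> (shear_coord \<omega> (x - snd (snd \<omega>))) \<partial>lborel)) (at x)"
proof -
  define D where "D z u = complex_of_real (u $ 1) * partial (axis 1 1) \<psi> z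
    + complex_of_real (u $ 2) * partial (axis 2 1) \<psi> z" for z and u :: "real^2"
  have D: "partial u \<psi> z = D z u" for z u
    unfolding D_def
    by (rule partial_plane[OF smooth_on_differentiable[OF schwartz_smooth[OF \<psi>]]]) simp
  have p: "partial (axis 1 1) \<psi> \<in> schwartz" "partial (axis 2 1) \<psi> \<in> schwartz"
    by (auto intro!: schwartz_partial[OF \<psi>] simp: Basis_plane)
  obtain C1 where C1: "C1 \<ge> 0" "\<And>z. (1 + norm z) ^ 0 * norm (partial (axis 1 1) \<psi> z) \<le> C1"
    using schwartz_norm_power_bound[OF p(1)] by blast
  obtain C2 where C2: "C2 \<ge> 0" "\<And>z. (1 + norm z) ^ 0 * norm (partial (axis 2 1) \<psi> z) \<le> C2"
    using schwartz_norm_power_bound[OF p(2)] by blast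
  have Dbd: "norm (D z u) \<le> (C1 + C2) * norm u" for z u
  proof -
    have "norm (D z u) \<le> \<bar>u $ 1\<bar> * norm (partial (axis 1 1) \<psi> z) + \<bar>u $ 2\<bar> * norm (partial (axis 2 1) \<psi> z)"
      unfolding D_def by (rule order_trans[OF norm_triangle_ineq]) (simp add: norm_mult)
    also have "\<dots> \<le> norm u * C1 + norm u * C2"
      using C1 C2 by (intro add_mono mult_mono component_le_norm_cart) auto
    finally show ?thesis by (simp add: algebra_simps)
  qed
  note [measurable] = schwartz_borel_measurable[OF p(1)] schwartz_borel_measurable[OF p(2)] rapidD(1)[OF F]
  show ?thesis
    unfolding superpose_def[abs_def]
  proof (rule has_derivative_lebesgue_integral[where w = "\<lambda>\<omega>. 2 * (C1 + C2) * (param_weight \<omega> * norm (F \<omega>))"])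
    show "integrable lborel (shearlet_kernel \<psi> F x)" for x by (rule integrable_shearlet_kernel[OF \<psi> F])
    show "((\<lambda>x. shearlet_kernel \<psi> F x \<omega>) has_derivative
        (\<lambda>v. F \<omega> * partial (shear_coord \<omega> v) \<psi> (shear_coord \<omega> (x - snd (snd \<omega>))))) (at x)" for x \<omega>
      unfolding shearlet_kernel_def
    proof (rule bounded_linear.has_derivative[OF bounded_linear_mult_right])
      have "((\<lambda>x. shear_coord \<omega> (x - snd (snd \<omega>))) has_derivative shear_coord \<omega>) (at x)"
        unfolding shear_coord_diff
        using has_derivative_diff[OF linear_imp_has_derivative[OF linear_shear_coord] has_derivative_const] by simp
      then show "((\<lambda>x. \<psi> (shear_coord \<omega> (x - snd (snd \<omega>)))) has_derivative
          (\<lambda>v. partial (shear_coord \<omega> v) \<psi> (shear_coord \<omega> (x - snd (snd \<omega>))))) (at x)"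
        by (rule has_derivative_compose)
          (rule partial_has_derivative, rule smooth_on_differentiable[OF schwartz_smooth[OF \<psi>]], simp)
    qed
    show "norm (F \<omega> * partial (shear_coord \<omega> v) \<psi> (shear_coord \<omega> (x - snd (snd \<omega>))))
        \<le> 2 * (C1 + C2) * (param_weight \<omega> * norm (F \<omega>)) * norm v" for x \<omega> v
    proof -
      have "norm (D z (shear_coord \<omega> v)) \<le> (C1 + C2) * (2 * param_weight \<omega> * norm v)" for z
        by (rule order_trans[OF Dbd mult_left_mono[OF norm_shear_coord_le]]) (use C1 C2 in auto)
      then show ?thesis unfolding D norm_mult
        by (rule order_trans[OF mult_left_mono]) (auto simp: mult_ac)
    qed
    obtain B where B: "\<And>\<omega>. param_weight \<omega> ^ 9 * norm (F \<omega>) \<le> B" using rapidE[OF F] by blast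
    have [measurable]: "param_weight \<in> borel_measurable borel" unfolding param_weight_def[abs_def] by measurable
    have "integrable lborel (\<lambda>\<omega>. param_weight \<omega> * norm (F \<omega>))"
    proof (rule Bochner_Integration.integrable_bound)
      show "integrable lborel (\<lambda>\<omega>::shearlet_param. B * (1 / (1 + norm \<omega>) ^ 8))"
        by (intro integrable_mult_right integrable_inverse_norm_power) simp
      show "AE \<omega> in lborel. norm (param_weight \<omega> * norm (F \<omega>)) \<le> norm (B * (1 / (1 + norm \<omega>) ^ 8))"
      proof (rule AE_I2)
        fix \<omega> :: shearlet_param
        have W: "1 \<le> param_weight \<omega>" by (rule param_weight_ge)
        have "param_weight \<omega> * norm (F \<omega>) * (1 + norm \<omega>) ^ 8 \<le> param_weight \<omega> * norm (F \<omega>) * param_weight \<omega> ^ 8"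
          using W param_weight_ge(2)[of \<omega>] by (intro mult_left_mono power_mono) auto
        also have "\<dots> = param_weight \<omega> ^ 9 * norm (F \<omega>)" by (simp add: eval_nat_numeral mult_ac)
        also have "\<dots> \<le> B" by (rule B)
        finally have "param_weight \<omega> * norm (F \<omega>) * (1 + norm \<omega>) ^ 8 \<le> B" .
        moreover have "0 < (1 + norm \<omega>) ^ 8" by (intro zero_less_power) (simp add: add_pos_nonneg)
        ultimately have "param_weight \<omega> * norm (F \<omega>) \<le> B / (1 + norm \<omega>) ^ 8"
          by (simp only: pos_le_divide_eq)
        then show "norm (param_weight \<omega> * norm (F \<omega>)) \<le> norm (B * (1 / (1 + norm \<omega>) ^ 8))"
          using W by (simp add: order_trans[OF _ divide_right_mono[OF abs_ge_self]])
      qed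
    qed measurable
    then show "integrable lborel (\<lambda>\<omega>. 2 * (C1 + C2) * (param_weight \<omega> * norm (F \<omega>)))" by simp
    show "(\<lambda>\<omega>. F \<omega> * partial (shear_coord \<omega> v) \<psi> (shear_coord \<omega> (x - snd (snd \<omega>)))) \<in> borel_measurable lborel" for x v
      unfolding D unfolding D_def by measurable
  qed
qed

lemma partial_superpose:
  assumes \<psi>: "\<psi> \<in> schwartz" and F: "rapid F" and v: "norm v = 1"
  shows "partial v (superpose \<psi> F) x =
    superpose (partial (axis 1 1) \<psi>) (coord_mult (axis 1 1) v F) x +
    superpose (partial (axis 2 1) \<psi>) (coord_mult (axis 2 1) v F) x"
proof -
  have p: "partial (axis 1 1) \<psi> \<in> schwartz" "partial (axis 2 1) \<psi> \<in> schwartz"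
    by (auto intro!: schwartz_partial[OF \<psi>] simp: Basis_plane)
  have r: "rapid (coord_mult (axis 1 1) v F)" "rapid (coord_mult (axis 2 1) v F)"
    by (auto intro!: rapid_coord_mult F v)
  have *: "partial u \<psi> z = complex_of_real (u $ 1) * partial (axis 1 1) \<psi> z
    + complex_of_real (u $ 2) * partial (axis 2 1) \<psi> z" for u z
    by (rule partial_plane[OF smooth_on_differentiable[OF schwartz_smooth[OF \<psi>]]]) simp
  have "partial v (superpose \<psi> F) x =
      (\<integral>\<omega>. F \<omega> * partial (shear_coord \<omega> v) \<psi> (shear_coord \<omega> (x - snd (snd \<omega>))) \<partial>lborel)"
    by (rule partial_eqI[OF superpose_has_derivative[OF \<psi> F]])
  also have "\<dots> = (\<integral>\<omega>. shearlet_kernel (partial (axis 1 1) \<psi>) (coord_mult (axis 1 1) v F) x \<omega> +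
      shearlet_kernel (partial (axis 2 1) \<psi>) (coord_mult (axis 2 1) v F) x \<omega> \<partial>lborel)"
    by (rule Bochner_Integration.integral_cong[OF refl])
      (subst *, simp add: shearlet_kernel_def coord_mult_def inner_axis algebra_simps del: shear_coord_nth)
  also have "\<dots> = superpose (partial (axis 1 1) \<psi>) (coord_mult (axis 1 1) v F) x +
      superpose (partial (axis 2 1) \<psi>) (coord_mult (axis 2 1) v F) x"
    unfolding superpose_def
    by (rule Bochner_Integration.integral_add) (intro integrable_shearlet_kernel p r)+
  finally show ?thesis .
qed

lemma smooth_superpose:
  assumes "\<psi> \<in> schwartz" "rapid F"
  shows "smooth_on UNIV (superpose \<psi> F)"
proof -
  have "Ck_on k UNIV (superpose \<psi> F)" for k
    using assms
  proof (induction k arbitrary: \<psi> F)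
    case 0
    have "isCont (superpose \<psi> F) x" for x
      using has_derivative_continuous[OF superpose_has_derivative[OF 0]] .
    then show ?case by (simp add: continuous_on_eq_continuous_at)
  next
    case (Suc k)
    have "Ck_on k UNIV (partial v (superpose \<psi> F))" if v: "v \<in> Basis" for v
    proof -
      have "partial v (superpose \<psi> F) = (\<lambda>x.
          superpose (partial (axis 1 1) \<psi>) (coord_mult (axis 1 1) v F) x +
          superpose (partial (axis 2 1) \<psi>) (coord_mult (axis 2 1) v F) x)"
        using partial_superpose[OF Suc.prems] v by auto
      moreover have "partial (axis 1 1) \<psi> \<in> schwartz" "partial (axis 2 1) \<psi> \<in> schwartz"
        by (auto intro!: schwartz_partial Suc.prems simp: Basis_plane)
      moreover have "rapid (coord_mult (axis 1 1) v F)" "rapid (coord_mult (axis 2 1) v F)"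
        using v by (auto intro!: rapid_coord_mult Suc.prems)
      ultimately show ?thesis using Suc.IH by (simp add: Ck_on_add)
    qed
    moreover have "superpose \<psi> F differentiable (at x)" for x
      using superpose_has_derivative[OF Suc.prems] unfolding differentiable_def by blast
    ultimately show ?case by simp
  qed
  then show ?thesis unfolding smooth_on_def by blast
qed

lemma param_weight_mono:
  assumes "n \<le> N"
  shows "param_weight \<omega> ^ n * norm (z::complex) \<le> param_weight \<omega> ^ N * norm z"
  using assms param_weight_ge(1) by (intro mult_right_mono power_increasing) auto

lemma superpose_bound:
  assumes "set vs \<subseteq> Basis" "\<psi> \<in> schwartz"
  shows "\<exists>N C. \<forall>F B x. rapid F \<longrightarrow> (\<forall>\<omega>. param_weight \<omega> ^ N * norm (F \<omega>) \<le> B) \<longrightarrow>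
    (1 + norm x) ^ k * norm (foldr partial vs (superpose \<psi> F) x) \<le> C * B"
  using assms
proof (induction vs arbitrary: \<psi> rule: rev_induct)
  case Nil
  obtain C where C: "\<forall>F B x \<omega>. rapid F \<longrightarrow>
      (\<forall>\<omega>. param_weight \<omega> ^ (2 * k + 8) * norm (F \<omega>) \<le> B) \<longrightarrow>
      (1 + norm x) ^ k * norm (shearlet_kernel \<psi> F x \<omega>) \<le> C * B / (1 + norm \<omega>) ^ 8"
    using shearlet_kernel_bound[OF Nil(2), of k 8] by (elim exE conjE)
  define I where "I = (\<integral>(\<omega>::shearlet_param). 1 / (1 + norm \<omega>) ^ 8 \<partial>lborel)"
  have "(1 + norm x) ^ k * norm (superpose \<psi> F x) \<le> (C * I) * B"
    if F: "rapid F" and B: "\<forall>\<omega>. param_weight \<omega> ^ (2 * k + 8) * norm (F \<omega>) \<le> B" for F B x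
  proof -
    have "(1 + norm x) ^ k * norm (superpose \<psi> F x) \<le>
        (1 + norm x) ^ k * (\<integral>\<omega>. norm (shearlet_kernel \<psi> F x \<omega>) \<partial>lborel)"
      unfolding superpose_def by (intro mult_left_mono integral_norm_bound) simp
    also have "\<dots> = (\<integral>\<omega>. (1 + norm x) ^ k * norm (shearlet_kernel \<psi> F x \<omega>) \<partial>lborel)" by simp
    also have "\<dots> \<le> (\<integral>(\<omega>::shearlet_param). (C * B) * (1 / (1 + norm \<omega>) ^ 8) \<partial>lborel)"
    proof (rule Bochner_Integration.integral_mono)
      show "integrable lborel (\<lambda>\<omega>. (1 + norm x) ^ k * norm (shearlet_kernel \<psi> F x \<omega>))"
        by (intro integrable_mult_right integrable_norm integrable_shearlet_kernel[OF Nil(2) F])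
      show "integrable lborel (\<lambda>\<omega>::shearlet_param. (C * B) * (1 / (1 + norm \<omega>) ^ 8))"
        by (intro integrable_mult_right integrable_inverse_norm_power) simp
      show "(1 + norm x) ^ k * norm (shearlet_kernel \<psi> F x \<omega>) \<le> (C * B) * (1 / (1 + norm \<omega>) ^ 8)" for \<omega>
        using C[rule_format, OF F B[rule_format], of x \<omega>] by simp
    qed
    also have "\<dots> = (C * I) * B" unfolding I_def by (subst integral_mult_right_zero) (simp add: mult_ac)
    finally show ?thesis .
  qed
  then show ?case by (intro exI[of _ "2 * k + 8"] exI[of _ "C * I"]) simp
next
  case (snoc v vs)
  have vs: "set vs \<subseteq> Basis" and v: "v \<in> Basis" using snoc.prems by auto
  define p1 where "p1 = partial (axis 1 1) \<psi>"
  define p2 where "p2 = partial (axis 2 1) \<psi>"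
  have p: "p1 \<in> schwartz" "p2 \<in> schwartz"
    unfolding p1_def p2_def by (auto intro!: schwartz_partial[OF snoc.prems(2)] simp: Basis_plane)
  obtain N1 C1 where 1: "\<forall>F B x. rapid F \<longrightarrow> (\<forall>\<omega>. param_weight \<omega> ^ N1 * norm (F \<omega>) \<le> B) \<longrightarrow>
    (1 + norm x) ^ k * norm (foldr partial vs (superpose p1 F) x) \<le> C1 * B"
    using snoc.IH[OF vs p(1)] by (elim exE)
  obtain N2 C2 where 2: "\<forall>F B x. rapid F \<longrightarrow> (\<forall>\<omega>. param_weight \<omega> ^ N2 * norm (F \<omega>) \<le> B) \<longrightarrow>
    (1 + norm x) ^ k * norm (foldr partial vs (superpose p2 F) x) \<le> C2 * B"
    using snoc.IH[OF vs p(2)] by (elim exE)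
  define N where "N = Suc (max N1 N2)"
  have "(1 + norm x) ^ k * norm (foldr partial (vs @ [v]) (superpose \<psi> F) x) \<le> (2 * C1 + 2 * C2) * B"
    if F: "rapid F" and B: "\<forall>\<omega>. param_weight \<omega> ^ N * norm (F \<omega>) \<le> B" for F B x
  proof -
    let ?F1 = "coord_mult (axis 1 1) v F" and ?F2 = "coord_mult (axis 2 1) v F"
    have nv: "norm v = 1" using v by simp
    have r: "rapid ?F1" "rapid ?F2"
      by (auto intro!: rapid_coord_mult F nv)
    have "param_weight \<omega> ^ N1 * norm (?F1 \<omega>) \<le> 2 * B" for \<omega>
      using B[rule_format, of \<omega>] param_weight_mono[of "Suc N1" N \<omega> "F \<omega>"]
      by (intro coord_mult_bound nv) (auto simp: N_def)
    then have b1: "(1 + norm x) ^ k * norm (foldr partial vs (superpose p1 ?F1) x) \<le> C1 * (2 * B)"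
      using 1 r(1) by blast
    have "param_weight \<omega> ^ N2 * norm (?F2 \<omega>) \<le> 2 * B" for \<omega>
      using B[rule_format, of \<omega>] param_weight_mono[of "Suc N2" N \<omega> "F \<omega>"]
      by (intro coord_mult_bound nv) (auto simp: N_def)
    then have b2: "(1 + norm x) ^ k * norm (foldr partial vs (superpose p2 ?F2) x) \<le> C2 * (2 * B)"
      using 2 r(2) by blast
    have "partial v (superpose \<psi> F) = (\<lambda>x. superpose p1 ?F1 x + superpose p2 ?F2 x)"
      unfolding p1_def p2_def using partial_superpose[OF snoc.prems(2) F nv] by auto
    then have "foldr partial (vs @ [v]) (superpose \<psi> F) x =
        foldr partial vs (superpose p1 ?F1) x + foldr partial vs (superpose p2 ?F2) x"
      using foldr_partial_add[OF open_UNIV smooth_superpose[OF p(1) r(1)] smooth_superpose[OF p(2) r(2)] vs UNIV_I]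
      by simp
    then have "(1 + norm x) ^ k * norm (foldr partial (vs @ [v]) (superpose \<psi> F) x) \<le>
        (1 + norm x) ^ k * (norm (foldr partial vs (superpose p1 ?F1) x) + norm (foldr partial vs (superpose p2 ?F2) x))"
      by (simp only:) (intro mult_left_mono norm_triangle_ineq, simp)
    then show ?thesis using b1 b2 by (simp add: algebra_simps)
  qed
  then show ?case by (intro exI[of _ N] exI[of _ "2 * C1 + 2 * C2"]) simp
qed

lemma superpose_schwartz_weight_bound:
  assumes "\<psi> \<in> schwartz"
  shows "\<exists>N C. \<forall>F B x. rapid F \<longrightarrow> (\<forall>\<omega>. param_weight \<omega> ^ N * norm (F \<omega>) \<le> B) \<longrightarrow>
    schwartz_weight k \<alpha>1 \<alpha>2 (superpose \<psi> F) x \<le> C * B"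
proof -
  have "schwartz_weight k \<alpha>1 \<alpha>2 (superpose \<psi> F) x \<le> (1 + norm x) ^ k *
      norm (foldr partial (replicate \<alpha>2 (axis 2 1) @ replicate \<alpha>1 (axis 1 1)) (superpose \<psi> F) x)" for F x
    unfolding schwartz_weight_foldr
    by (intro mult_right_mono power_mono bracket_le_one_plus_norm) (auto simp: bracket_pos less_imp_le)
  then show ?thesis
    using superpose_bound[OF replicate_axis_subset[of \<alpha>2 2 \<alpha>1 1] assms, of k] by (meson order_trans)
qed

lemma superpose_schwartz:
  assumes "\<psi> \<in> schwartz" and F: "rapid F"
  shows "superpose \<psi> F \<in> schwartz"
proof (rule schwartzI[OF smooth_superpose[OF assms]])
  fix k \<alpha>1 \<alpha>2
  obtain N C where "\<forall>F B x. rapid F \<longrightarrow> (\<forall>\<omega>. param_weight \<omega> ^ N * norm (F \<omega>) \<le> B) \<longrightarrow>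
    schwartz_weight k \<alpha>1 \<alpha>2 (superpose \<psi> F) x \<le> C * B"
    using superpose_schwartz_weight_bound[OF assms(1), of k \<alpha>1 \<alpha>2] by (elim exE)
  moreover obtain B where "\<And>\<omega>. param_weight \<omega> ^ N * norm (F \<omega>) \<le> B" using rapidE[OF F, of N] by blast
  ultimately show "\<exists>C. \<forall>x. schwartz_weight k \<alpha>1 \<alpha>2 (superpose \<psi> F) x \<le> C"
    using F by blast
qed

definition null_moments :: "(real^2 \<Rightarrow> complex) \<Rightarrow> (real^2 \<Rightarrow> real) \<Rightarrow> bool"
  where "null_moments \<psi> q \<longleftrightarrow> (\<forall>m1 m2.
    integrable lborel (\<lambda>z. complex_of_real (z$1 ^ m1 * z$2 ^ m2 * q z) * \<psi> z) \<and>
    (\<integral>z. complex_of_real (z$1 ^ m1 * z$2 ^ m2 * q z) * \<psi> z \<partial>lborel) = 0)"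

lemma norm_monomial_le: "norm (complex_of_real ((x::real^2)$1 ^ m1 * x$2 ^ m2)) \<le> (1 + norm x) ^ (m1 + m2)"
proof -
  have "\<bar>x$i\<bar> \<le> 1 + norm x" for i using component_le_norm_cart[of x i] by simp
  then have "\<bar>x$1\<bar> ^ m1 * \<bar>x$2\<bar> ^ m2 \<le> (1 + norm x) ^ m1 * (1 + norm x) ^ m2"
    by (intro mult_mono power_mono) auto
  then show ?thesis by (simp only: norm_of_real abs_mult power_abs power_add)
qed

lemma integrable_monomial_schwartz:
  assumes \<psi>: "\<psi> \<in> schwartz"
  shows "integrable lborel (\<lambda>x. complex_of_real (x$1 ^ m1 * x$2 ^ m2) * \<psi> x)"
proof -
  note [measurable] = schwartz_borel_measurable[OF \<psi>]
  obtain C where C: "\<And>z. (1 + norm z) ^ (m1 + m2 + 4) * norm (\<psi> z) \<le> C"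
    using schwartz_norm_power_bound[OF \<psi>] by blast
  show ?thesis
  proof (rule integrable_norm_power_bound)
    show "norm (complex_of_real (x$1 ^ m1 * x$2 ^ m2) * \<psi> x) \<le> C / (1 + norm x) ^ 4" for x
    proof -
      have "norm (complex_of_real (x$1 ^ m1 * x$2 ^ m2) * \<psi> x) * (1 + norm x) ^ 4
          \<le> (1 + norm x) ^ (m1 + m2) * norm (\<psi> x) * (1 + norm x) ^ 4"
        unfolding norm_mult by (intro mult_right_mono norm_monomial_le) auto
      also have "\<dots> \<le> C" using C[of x] by (simp add: power_add mult_ac)
      finally have "norm (complex_of_real (x$1 ^ m1 * x$2 ^ m2) * \<psi> x) * (1 + norm x) ^ 4 \<le> C" .
      moreover have "0 < (1 + norm x) ^ 4" by (intro zero_less_power) (simp add: add_pos_nonneg)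
      ultimately show ?thesis by (simp only: pos_le_divide_eq)
    qed
  qed simp_all
qed

lemma null_moments_lizorkin: "\<psi> \<in> lizorkin \<Longrightarrow> null_moments \<psi> (\<lambda>z. 1)"
  unfolding null_moments_def lizorkin_def by (simp add: integrable_monomial_schwartz del: of_real_mult)

lemma null_moments_affine:
  assumes "null_moments \<psi> q"
  shows "null_moments \<psi> (\<lambda>z. (c + d * z$1 + e * z$2) * q z)"
  unfolding null_moments_def
proof (intro allI)
  fix m1 m2
  let ?f = "\<lambda>m1 m2 z. complex_of_real (z$1 ^ m1 * z$2 ^ m2 * q z) * \<psi> z"
  have f: "integrable lborel (?f m1 m2)" "integral\<^sup>L lborel (?f m1 m2) = 0" for m1 m2
    using assms unfolding null_moments_def by auto
  have eq: "(\<lambda>z. complex_of_real (z$1 ^ m1 * z$2 ^ m2 * ((c + d * z$1 + e * z$2) * q z)) * \<psi> z) =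
      (\<lambda>z. of_real c * ?f m1 m2 z + of_real d * ?f (Suc m1) m2 z + of_real e * ?f m1 (Suc m2) z)"
    by (rule ext) (simp add: algebra_simps)
  show "integrable lborel (\<lambda>z. complex_of_real (z$1 ^ m1 * z$2 ^ m2 * ((c + d * z$1 + e * z$2) * q z)) * \<psi> z) \<and>
    (\<integral>z. complex_of_real (z$1 ^ m1 * z$2 ^ m2 * ((c + d * z$1 + e * z$2) * q z)) * \<psi> z \<partial>lborel) = 0"
    unfolding eq
  proof
    show "integrable lborel (\<lambda>z. of_real c * ?f m1 m2 z + of_real d * ?f (Suc m1) m2 z + of_real e * ?f m1 (Suc m2) z)"
      by (intro Bochner_Integration.integrable_add integrable_mult_right f)
    have "(\<integral>z. of_real c * ?f m1 m2 z + of_real d * ?f (Suc m1) m2 z + of_real e * ?f m1 (Suc m2) z \<partial>lborel)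
        = of_real c * integral\<^sup>L lborel (?f m1 m2) + of_real d * integral\<^sup>L lborel (?f (Suc m1) m2)
          + of_real e * integral\<^sup>L lborel (?f m1 (Suc m2))"
      by (subst Bochner_Integration.integral_add, (intro Bochner_Integration.integrable_add integrable_mult_right f)+,
          subst Bochner_Integration.integral_add, (intro integrable_mult_right f)+)
        (simp only: integral_mult_right_zero)
    then show "(\<integral>z. of_real c * ?f m1 m2 z + of_real d * ?f (Suc m1) m2 z + of_real e * ?f m1 (Suc m2) z \<partial>lborel) = 0"
      unfolding f(2) by simp
  qed
qed

lemma null_moments_affine_power:
  assumes "null_moments \<psi> q"
  shows "null_moments \<psi> (\<lambda>z. (c + d * z$1 + e * z$2) ^ n * q z)"
proof (induction n)
  case (Suc n)
  show ?case using null_moments_affine[OF Suc, of c d e] by (simp only: power_Suc mult.assoc)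
qed (use assms in simp)

lemma integral_linear_zero:
  fixes g :: "real^2 \<Rightarrow> complex" and L :: "real^2 \<Rightarrow> real^2"
  assumes L: "linear L" "surj L" and int: "integrable lborel (\<lambda>z. g (L z))"
    and zero: "(\<integral>z. g (L z) \<partial>lborel) = 0"
  shows "(\<integral>x. g x \<partial>lborel) = 0"
proof (cases "integrable lborel g")
  case True
  define \<phi> :: "complex \<Rightarrow> real^2" where "\<phi> z = Re z *\<^sub>R axis 1 1 + Im z *\<^sub>R axis 2 1" for z
  have \<phi>: "bounded_linear \<phi>"
    unfolding linear_conv_bounded_linear[symmetric]
    by (rule linearI) (simp_all add: \<phi>_def algebra_simps)
  have \<phi>0: "z = 0" if "\<phi> z = 0" for z
  proof -
    have "\<phi> z $ 1 = Re z" "\<phi> z $ 2 = Im z" by (simp_all add: \<phi>_def axis_def)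
    with that show ?thesis by (simp add: complex_eq_iff)
  qed
  have i1: "integrable lborel (\<lambda>z. \<phi> (g (L z)))" and i2: "integrable lborel (\<lambda>z. \<phi> (g z))"
    by (rule integrable_bounded_linear[OF \<phi>], fact)+
  have "((\<lambda>z. \<phi> (g z)) \<circ> L) absolutely_integrable_on UNIV"
    using i1 borel_measurable_integrable[OF i1]
    by (simp add: set_integrable_def comp_def integrable_completion)
  then have "integral (range L) (\<lambda>z. \<phi> (g z)) = \<bar>det (matrix L)\<bar> *\<^sub>R integral UNIV ((\<lambda>z. \<phi> (g z)) \<circ> L)"
    using integral_change_of_variables_linear[OF L(1), where f = "\<lambda>z. \<phi> (g z)" and S = UNIV] by blast
  then have "integral UNIV (\<lambda>z. \<phi> (g z)) = \<bar>det (matrix L)\<bar> *\<^sub>R integral UNIV (\<lambda>z. \<phi> (g (L z)))"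
    using L(2) by (simp add: comp_def)
  also have "integral UNIV (\<lambda>z. \<phi> (g (L z))) = (\<integral>z. \<phi> (g (L z)) \<partial>lborel)" by (rule integral_lborel[OF i1])
  also have "\<dots> = \<phi> (\<integral>z. g (L z) \<partial>lborel)" by (rule integral_bounded_linear[OF \<phi> int])
  also have "\<dots> = 0" unfolding zero by (simp add: \<phi>_def)
  finally have "(\<integral>z. \<phi> (g z) \<partial>lborel) = 0" using integral_lborel[OF i2] by simp
  then have "\<phi> (\<integral>z. g z \<partial>lborel) = 0" using integral_bounded_linear[OF \<phi> True] by simp
  then show ?thesis by (rule \<phi>0)
qed (rule not_integrable_integral_eq)

lemma shear_coord_moment:
  assumes \<psi>: "\<psi> \<in> lizorkin" and a: "fst \<omega> \<noteq> 0"
  shows "(\<integral>x. complex_of_real (x$1 ^ m1 * x$2 ^ m2) * \<psi> (shear_coord \<omega> (x - snd (snd \<omega>))) \<partial>lborel) = 0"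
proof -
  define b where "b = snd (snd \<omega>)"
  define s where "s = fst (snd \<omega>)"
  define q where "q = fst \<omega> / sqrt \<bar>fst \<omega>\<bar>"
  define h where "h y = complex_of_real ((b$1 + y$1) ^ m1 * (b$2 + y$2) ^ m2) * \<psi> (shear_coord \<omega> y)" for y
  define L :: "real^2 \<Rightarrow> real^2"
    where "L z = (fst \<omega> * z$1 - s * (q * z$2)) *\<^sub>R axis 1 1 + (q * z$2) *\<^sub>R axis 2 1" for z
  have Ln: "L z $ 1 = fst \<omega> * z$1 - s * (q * z$2)" "L z $ 2 = q * z$2" for z
    by (simp_all add: L_def axis_def)
  have sL: "shear_coord \<omega> (L z) = z" for z
    using a by (simp add: vec_eq_iff forall_2 Ln s_def[symmetric] q_def)
  have LS: "L (shear_coord \<omega> y) = y" for y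
    using a by (simp add: vec_eq_iff forall_2 Ln s_def[symmetric] q_def)
  have lin: "linear L" by (rule linearI) (simp_all add: vec_eq_iff forall_2 Ln algebra_simps)
  have surj: "surj L" using LS by (metis surjI)
  have meas[measurable]: "\<psi> \<in> borel_measurable borel"
    using \<psi> by (auto simp: lizorkin_def intro: schwartz_borel_measurable)
  have hL: "h (L z) = complex_of_real (z$1 ^ 0 * z$2 ^ 0 *
      ((b$1 + fst \<omega> * z$1 + (- s * q) * z$2) ^ m1 * ((b$2 + 0 * z$1 + q * z$2) ^ m2 * 1))) * \<psi> z" for z
    unfolding h_def sL Ln by (simp add: algebra_simps)
  have "null_moments \<psi> (\<lambda>z. (b$1 + fst \<omega> * z$1 + (- s * q) * z$2) ^ m1 * ((b$2 + 0 * z$1 + q * z$2) ^ m2 * 1))"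
    by (intro null_moments_affine_power null_moments_lizorkin \<psi>)
  then have "integrable lborel (\<lambda>z. h (L z))" "(\<integral>z. h (L z) \<partial>lborel) = 0"
    unfolding hL null_moments_def by blast+
  from integral_linear_zero[OF lin surj this] have h0: "(\<integral>x. h x \<partial>lborel) = 0" .
  let ?g = "\<lambda>x. complex_of_real (x$1 ^ m1 * x$2 ^ m2) * \<psi> (shear_coord \<omega> (x - b))"
  have "(\<integral>x. ?g x \<partial>lborel) = (\<integral>x. ?g x \<partial>(distr lborel borel ((+) b)))"
    by (simp add: lborel_distr_plus)
  also have "\<dots> = (\<integral>y. ?g (b + y) \<partial>lborel)"
    by (rule integral_distr) (measurable)
  also have "\<dots> = (\<integral>y. h y \<partial>lborel)" by (simp add: h_def)
  finally show ?thesis using h0 unfolding b_def by simp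
qed

lemma superpose_moment:
  assumes \<psi>: "\<psi> \<in> lizorkin" and F: "rapid F"
  shows "(\<integral>x. complex_of_real (x$1 ^ m1 * x$2 ^ m2) * superpose \<psi> F x \<partial>lborel) = 0"
proof -
  have \<psi>S: "\<psi> \<in> schwartz" using \<psi> by (simp add: lizorkin_def)
  note [measurable] = schwartz_borel_measurable[OF \<psi>S] rapidD(1)[OF F]
  define f where "f x \<omega> = complex_of_real (x$1 ^ m1 * x$2 ^ m2) * shearlet_kernel \<psi> F x \<omega>" for x \<omega>
  have fm: "(\<lambda>p. f (fst p) (snd p)) \<in> borel_measurable borel" unfolding f_def by measurable
  obtain C where C: "\<forall>F B x \<omega>. rapid F \<longrightarrow>
      (\<forall>\<omega>. param_weight \<omega> ^ (2 * (m1 + m2 + 12) + 12) * norm (F \<omega>) \<le> B) \<longrightarrow>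
      (1 + norm x) ^ (m1 + m2 + 12) * norm (shearlet_kernel \<psi> F x \<omega>) \<le> C * B / (1 + norm \<omega>) ^ 12"
    using shearlet_kernel_bound[OF \<psi>S, of "m1 + m2 + 12" 12] by (elim exE conjE)
  obtain B where B: "\<And>\<omega>. param_weight \<omega> ^ (2 * (m1 + m2 + 12) + 12) * norm (F \<omega>) \<le> B"
    using rapidE[OF F, of "2 * (m1 + m2 + 12) + 12"] by blast
  have bd: "norm (f (fst p) (snd p)) \<le> C * B / (1 + norm p) ^ 12" for p
  proof -
    obtain x \<omega> where p: "p = (x, \<omega>)" by (cases p)
    have "norm p \<le> norm x + norm \<omega>" unfolding p by (rule norm_Pair_le)
    also have "1 + \<dots> \<le> (1 + norm x) * (1 + norm \<omega>)" by (simp add: algebra_simps)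
    finally have le: "1 + norm p \<le> (1 + norm x) * (1 + norm \<omega>)" by simp
    have pos: "0 < (1 + norm p) ^ 12" "0 < (1 + norm \<omega>) ^ 12"
      by (intro zero_less_power; simp add: add_pos_nonneg)+
    have "norm (f x \<omega>) * (1 + norm p) ^ 12 \<le>
        ((1 + norm x) ^ (m1 + m2) * norm (shearlet_kernel \<psi> F x \<omega>)) * ((1 + norm x) * (1 + norm \<omega>)) ^ 12"
      unfolding f_def norm_mult
      by (intro mult_mono power_mono le mult_right_mono norm_monomial_le) auto
    also have "\<dots> = ((1 + norm x) ^ (m1 + m2 + 12) * norm (shearlet_kernel \<psi> F x \<omega>)) * (1 + norm \<omega>) ^ 12"
      by (simp add: power_add power_mult_distrib mult_ac)
    also have "\<dots> \<le> C * B"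
      using C[rule_format, OF F B, of x \<omega>] pos(2) by (simp only: pos_le_divide_eq)
    finally show ?thesis using pos(1) by (simp only: p fst_conv snd_conv pos_le_divide_eq)
  qed
  have "integrable lborel (\<lambda>p. f (fst p) (snd p))"
    by (rule integrable_norm_power_bound[OF fm bd]) simp
  then have int: "integrable (lborel \<Otimes>\<^sub>M lborel) (case_prod f)"
    by (simp add: lborel_prod case_prod_unfold)
  have "(\<integral>x. complex_of_real (x$1 ^ m1 * x$2 ^ m2) * superpose \<psi> F x \<partial>lborel) = (\<integral>x. \<integral>\<omega>. f x \<omega> \<partial>lborel \<partial>lborel)"
    unfolding superpose_def f_def by simp
  also have "\<dots> = (\<integral>\<omega>. \<integral>x. f x \<omega> \<partial>lborel \<partial>lborel)"
    by (rule lborel_pair.Fubini_integral[OF int, symmetric])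
  also have "\<dots> = (\<integral>(\<omega>::shearlet_param). 0 \<partial>lborel)"
  proof (rule Bochner_Integration.integral_cong[OF refl])
    fix \<omega> :: shearlet_param
    show "(\<integral>x. f x \<omega> \<partial>lborel) = 0"
    proof (cases "fst \<omega> = 0")
      case True
      then show ?thesis using rapidD(2)[OF F] by (simp add: f_def shearlet_kernel_def)
    next
      case False
      have "(\<integral>x. f x \<omega> \<partial>lborel) =
        (\<integral>x. F \<omega> * (complex_of_real (x$1 ^ m1 * x$2 ^ m2) * \<psi> (shear_coord \<omega> (x - snd (snd \<omega>)))) \<partial>lborel)"
        unfolding f_def shearlet_kernel_def by (simp only: mult.left_commute)
      also have "\<dots> = 0"
        unfolding integral_mult_right_zero shear_coord_moment[OF \<psi> False] by simp
      finally show ?thesis .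
    qed
  qed
  finally show ?thesis by simp
qed

lemma superpose_lizorkin: "\<psi> \<in> lizorkin \<Longrightarrow> rapid F \<Longrightarrow> superpose \<psi> F \<in> lizorkin"
  unfolding lizorkin_def by (simp add: superpose_schwartz superpose_moment[unfolded lizorkin_def] del: of_real_mult)

lemma topspace_schwartz_topology: "topspace schwartz_topology = schwartz"
  unfolding schwartz_topology_def
  by (rule topspace_seminorm_topology)
    (auto simp: schwartz_weight_foldr foldr_partial_zero simp del: foldr_append)

lemma topspace_lizorkin_topology: "topspace lizorkin_topology = lizorkin"
  unfolding lizorkin_topology_def topspace_subtopology topspace_schwartz_topology
  by (auto simp: lizorkin_def)

lemma lizorkinD:
  assumes "\<phi> \<in> lizorkin"
  shows "\<phi> \<in> schwartz" "(\<integral>x. complex_of_real (x$1 ^ m1 * x$2 ^ m2) * \<phi> x \<partial>lborel) = 0"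
  using assms unfolding lizorkin_def by blast+

lemma lizorkinI:
  assumes "\<phi> \<in> schwartz" "\<And>m1 m2. (\<integral>x. complex_of_real (x$1 ^ m1 * x$2 ^ m2) * \<phi> x \<partial>lborel) = 0"
  shows "\<phi> \<in> lizorkin"
  using assms unfolding lizorkin_def by blast

lemma lizorkin_subspace: "function_subspace lizorkin"
  unfolding function_subspace_def
proof (intro conjI ballI allI)
  note V = function_subspaceD[OF schwartz_subspace]
  show "(\<lambda>x. 0) \<in> lizorkin" by (rule lizorkinI[OF V(1)]) simp
  fix \<phi> \<psi> assume \<phi>: "\<phi> \<in> lizorkin" and \<psi>: "\<psi> \<in> lizorkin"
  note S = lizorkinD(1)[OF \<phi>] lizorkinD(1)[OF \<psi>]
  show "(\<lambda>x. \<phi> x + \<psi> x) \<in> lizorkin"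
    by (rule lizorkinI[OF V(2)[OF S]], unfold distrib_left,
        subst Bochner_Integration.integral_add[OF integrable_monomial_schwartz[OF S(1)] integrable_monomial_schwartz[OF S(2)]])
      (simp only: lizorkinD(2)[OF \<phi>] lizorkinD(2)[OF \<psi>] add_0)
next
  note V = function_subspaceD[OF schwartz_subspace]
  fix c \<phi> assume \<phi>: "\<phi> \<in> lizorkin"
  show "(\<lambda>x. c * \<phi> x) \<in> lizorkin"
    by (rule lizorkinI[OF V(3)[OF lizorkinD(1)[OF \<phi>]]], subst mult.left_commute)
      (simp only: integral_mult_right_zero lizorkinD(2)[OF \<phi>] mult_zero_right)
qed

lemma lizorkin_cnj:
  assumes \<phi>: "\<phi> \<in> lizorkin"
  shows "(\<lambda>x. cnj (\<phi> x)) \<in> lizorkin"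
proof (rule lizorkinI[OF schwartz_cnj[OF lizorkinD(1)[OF \<phi>]]])
  fix m1 m2
  have "(\<integral>x. complex_of_real (x$1 ^ m1 * x$2 ^ m2) * cnj (\<phi> x) \<partial>lborel) =
      (\<integral>x. cnj (complex_of_real (x$1 ^ m1 * x$2 ^ m2) * \<phi> x) \<partial>lborel)"
    by (simp only: complex_cnj_mult complex_cnj_complex_of_real)
  also have "\<dots> = cnj (\<integral>x. complex_of_real (x$1 ^ m1 * x$2 ^ m2) * \<phi> x \<partial>lborel)" 
    by (rule integral_bounded_linear[OF bounded_linear_cnj integrable_monomial_schwartz[OF lizorkinD(1)[OF \<phi>]]])
  also have "\<dots> = 0" unfolding lizorkinD(2)[OF \<phi>] by simp
  finally show "(\<integral>x. complex_of_real (x$1 ^ m1 * x$2 ^ m2) * cnj (\<phi> x) \<partial>lborel) = 0" .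
qed

section \<open>Test functions on the shearlet group\<close>

lemma open_shearlet_group: "open shearlet_group"
proof -
  have "shearlet_group = (\<lambda>y. snd (snd y)) -` (- {0})" by (auto simp: shearlet_group_def)
  moreover have "open \<dots>" by (intro open_vimage continuous_intros)
  ultimately show ?thesis by simp
qed

definition shearlet_directions :: "nat \<Rightarrow> nat \<Rightarrow> nat \<Rightarrow> nat \<Rightarrow> shearlet_point list"
  where "shearlet_directions \<alpha>1 \<alpha>2 \<beta> \<gamma> = replicate \<gamma> (0, 0, 1) @ replicate \<beta> (0, 1, 0) @
    replicate \<alpha>2 (axis 2 1, 0, 0) @ replicate \<alpha>1 (axis 1 1, 0, 0)"

lemma shearlet_directions_subset: "set (shearlet_directions \<alpha>1 \<alpha>2 \<beta> \<gamma>) \<subseteq> Basis"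
proof -
  have 1: "(u, 0, 0) \<in> Basis" if "u \<in> Basis" for u :: "real^2"
    using that unfolding zero_prod_def[symmetric] by (auto simp: Basis_prod_def)
  have 2: "(0, 1, 0) \<in> (Basis :: shearlet_point set)" "(0, 0, 1) \<in> (Basis :: shearlet_point set)"
    by (auto simp: Basis_prod_def)
  show ?thesis
    using 1[of "axis 1 1"] 1[of "axis 2 1"] 2 by (auto simp: shearlet_directions_def Basis_plane)
qed

definition shearlet_factor :: "nat \<Rightarrow> nat \<Rightarrow> nat \<Rightarrow> nat \<Rightarrow> shearlet_point \<Rightarrow> real"
  where "shearlet_factor k1 k2 l m = (\<lambda>(b, s, a).
    bracket (b$1) ^ k1 * bracket (b$2) ^ k2 * bracket s ^ l * (\<bar>a\<bar> ^ m + 1 / \<bar>a\<bar> ^ m))"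

lemma shearlet_weight_factor:
  "shearlet_weight k1 k2 l m \<alpha>1 \<alpha>2 \<beta> \<gamma> \<Phi> y =
    shearlet_factor k1 k2 l m y * norm (foldr partial (shearlet_directions \<alpha>1 \<alpha>2 \<beta> \<gamma>) \<Phi> y)"
  by (cases y) (simp add: shearlet_weight_def shearlet_factor_def shearlet_directions_def foldr_replicate)

lemma shearlet_factor_nonneg: "0 \<le> shearlet_factor k1 k2 l m y"
  by (cases y) (simp add: shearlet_factor_def bracket_pos less_imp_le)

lemma shearlet_testD:
  assumes "\<Phi> \<in> shearlet_test"
  shows "smooth_on shearlet_group \<Phi>"
    "bdd_above (shearlet_weight k1 k2 l m \<alpha>1 \<alpha>2 \<beta> \<gamma> \<Phi> ` shearlet_group)"
    "y \<notin> shearlet_group \<Longrightarrow> \<Phi> y = 0"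
proof -
  note * = assms[unfolded shearlet_test_def mem_Collect_eq]
  show "smooth_on shearlet_group \<Phi>" by (rule conjunct1[OF *])
  show "bdd_above (shearlet_weight k1 k2 l m \<alpha>1 \<alpha>2 \<beta> \<gamma> \<Phi> ` shearlet_group)"
    using conjunct1[OF conjunct2[OF *]] by (elim allE)
  show "\<Phi> y = 0" if "y \<notin> shearlet_group"
    using conjunct2[OF conjunct2[OF *]] that by (elim allE impE)
qed

lemma shearlet_testI:
  assumes "smooth_on shearlet_group \<Phi>"
    "\<And>k1 k2 l m \<alpha>1 \<alpha>2 \<beta> \<gamma>. \<exists>C. \<forall>y\<in>shearlet_group. shearlet_weight k1 k2 l m \<alpha>1 \<alpha>2 \<beta> \<gamma> \<Phi> y \<le> C"
    "\<And>y. y \<notin> shearlet_group \<Longrightarrow> \<Phi> y = 0"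
  shows "\<Phi> \<in> shearlet_test"
  unfolding shearlet_test_def mem_Collect_eq
proof (intro conjI allI impI assms)
  fix k1 k2 l m \<alpha>1 \<alpha>2 \<beta> \<gamma>
  show "bdd_above (shearlet_weight k1 k2 l m \<alpha>1 \<alpha>2 \<beta> \<gamma> \<Phi> ` shearlet_group)"
    using assms(2)[of k1 k2 l m \<alpha>1 \<alpha>2 \<beta> \<gamma>] by (auto simp: bdd_above_def)
qed

lemma shearlet_testE:
  assumes "\<Phi> \<in> shearlet_test"
  obtains C where "\<And>y. y \<in> shearlet_group \<Longrightarrow> shearlet_weight k1 k2 l m \<alpha>1 \<alpha>2 \<beta> \<gamma> \<Phi> y \<le> C"
  using shearlet_testD(2)[OF assms, of k1 k2 l m \<alpha>1 \<alpha>2 \<beta> \<gamma>] unfolding bdd_above_def by auto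

lemma shearlet_test_subspace: "function_subspace shearlet_test"
  unfolding function_subspace_def
proof (intro conjI ballI allI)
  show "(\<lambda>y. 0) \<in> shearlet_test"
    by (rule shearlet_testI)
      (auto simp: shearlet_weight_factor foldr_partial_zero smooth_on_const open_shearlet_group intro!: exI[of _ 0])
next
  fix \<Phi> \<Psi> assume \<Phi>: "\<Phi> \<in> shearlet_test" and \<Psi>: "\<Psi> \<in> shearlet_test"
  note S = shearlet_testD(1)[OF \<Phi>] shearlet_testD(1)[OF \<Psi>]
  show "(\<lambda>y. \<Phi> y + \<Psi> y) \<in> shearlet_test"
  proof (rule shearlet_testI)
    show "smooth_on shearlet_group (\<lambda>y. \<Phi> y + \<Psi> y)" by (rule smooth_on_add[OF open_shearlet_group S])
    show "\<Phi> y + \<Psi> y = 0" if "y \<notin> shearlet_group" for y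
      using shearlet_testD(3)[OF \<Phi> that] shearlet_testD(3)[OF \<Psi> that] by simp
    fix k1 k2 l m \<alpha>1 \<alpha>2 \<beta> \<gamma>
    let ?w = "shearlet_weight k1 k2 l m \<alpha>1 \<alpha>2 \<beta> \<gamma>"
    obtain C where C: "\<And>y. y \<in> shearlet_group \<Longrightarrow> ?w \<Phi> y \<le> C" using shearlet_testE[OF \<Phi>] by blast
    obtain D where D: "\<And>y. y \<in> shearlet_group \<Longrightarrow> ?w \<Psi> y \<le> D" using shearlet_testE[OF \<Psi>] by blast
    have "?w (\<lambda>y. \<Phi> y + \<Psi> y) y \<le> C + D" if y: "y \<in> shearlet_group" for y
    proof -
      have "?w (\<lambda>y. \<Phi> y + \<Psi> y) y \<le> ?w \<Phi> y + ?w \<Psi> y"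
        unfolding shearlet_weight_factor foldr_partial_add[OF open_shearlet_group S shearlet_directions_subset y]
          distrib_left[symmetric]
        by (intro mult_left_mono norm_triangle_ineq shearlet_factor_nonneg)
      then show ?thesis using C[OF y] D[OF y] by linarith
    qed
    then show "\<exists>C. \<forall>y\<in>shearlet_group. ?w (\<lambda>y. \<Phi> y + \<Psi> y) y \<le> C" by blast
  qed
next
  fix c \<Phi> assume \<Phi>: "\<Phi> \<in> shearlet_test"
  note S = shearlet_testD(1)[OF \<Phi>]
  show "(\<lambda>y. c * \<Phi> y) \<in> shearlet_test"
  proof (rule shearlet_testI)
    show "smooth_on shearlet_group (\<lambda>y. c * \<Phi> y)"
      by (rule smooth_on_bounded_linear[OF bounded_linear_mult_right open_shearlet_group S])
    show "c * \<Phi> y = 0" if "y \<notin> shearlet_group" for y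
      using shearlet_testD(3)[OF \<Phi> that] by simp
    fix k1 k2 l m \<alpha>1 \<alpha>2 \<beta> \<gamma>
    let ?w = "shearlet_weight k1 k2 l m \<alpha>1 \<alpha>2 \<beta> \<gamma>"
    obtain C where C: "\<And>y. y \<in> shearlet_group \<Longrightarrow> ?w \<Phi> y \<le> C" using shearlet_testE[OF \<Phi>] by blast
    have "?w (\<lambda>y. c * \<Phi> y) y = norm c * ?w \<Phi> y" if y: "y \<in> shearlet_group" for y
      unfolding shearlet_weight_factor
        foldr_partial_bounded_linear[OF bounded_linear_mult_right open_shearlet_group S shearlet_directions_subset y]
      by (simp add: norm_mult)
    then have "?w (\<lambda>y. c * \<Phi> y) y \<le> norm c * C" if y: "y \<in> shearlet_group" for y
      using that C[OF y] by (simp add: mult_left_mono)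
    then show "\<exists>C. \<forall>y\<in>shearlet_group. ?w (\<lambda>y. c * \<Phi> y) y \<le> C" by blast
  qed
qed

lemma shearlet_group_nonempty: "shearlet_group \<noteq> {}"
proof -
  have "(0, 0, 1) \<in> shearlet_group" by (simp add: shearlet_group_def)
  then show ?thesis by blast
qed

lemma topspace_shearlet_test_topology: "topspace shearlet_test_topology = shearlet_test"
  unfolding shearlet_test_topology_def
  by (rule topspace_seminorm_topology, blast)
    (auto simp: shearlet_weight_factor foldr_partial_zero shearlet_group_nonempty)

section \<open>The synthesis operator\<close>

text \<open>The weight \<open>\<bar>a\<bar>\<close> to the power \<open>- 15 / 4\<close> combines the normalisation of the representation with
  the density of the Haar measure.\<close>

definition synthesis_density :: "(shearlet_point \<Rightarrow> complex) \<Rightarrow> shearlet_param \<Rightarrow> complex"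
  where "synthesis_density \<Phi> \<omega> =
    \<Phi> (snd (snd \<omega>), fst (snd \<omega>), fst \<omega>) * complex_of_real (\<bar>fst \<omega>\<bar> powr (- 15 / 4))"

lemma param_weight_power_le:
  assumes a: "a \<noteq> 0"
  shows "param_weight (a, s, b) ^ n \<le> 32 ^ n * shearlet_factor n n n n (b, s, a)"
proof -
  define M where "M = max \<bar>a\<bar> (1 / \<bar>a\<bar>)"
  have M: "\<bar>a\<bar> \<le> M" "1 / \<bar>a\<bar> \<le> M" "1 \<le> M"
    using a by (auto simp: M_def le_max_iff_disj)
  have "norm (a, s, b) \<le> \<bar>a\<bar> + \<bar>s\<bar> + (\<bar>b$1\<bar> + \<bar>b$2\<bar>)"
    using norm_Pair_le[of a "(s, b)"] norm_Pair_le[of s b] norm_le_l1_cart[of b] by (simp add: sum_2)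
  also have "1 + \<dots> \<le> (1 + \<bar>a\<bar>) * (1 + \<bar>s\<bar>) * (1 + \<bar>b$1\<bar>) * (1 + \<bar>b$2\<bar>)"
    by (simp add: algebra_simps)
  finally have "param_weight (a, s, b) \<le> (1 + \<bar>a\<bar>) * (1 + \<bar>s\<bar>) * (1 + \<bar>b$1\<bar>) * (1 + \<bar>b$2\<bar>) * (1 + 1 / \<bar>a\<bar>)"
    unfolding param_weight_def fst_conv by (intro mult_right_mono) auto
  also have "\<dots> = ((1 + \<bar>a\<bar>) * (1 + 1 / \<bar>a\<bar>)) * ((1 + norm (b$1)) * (1 + norm (b$2)) * (1 + norm s))"
    by (simp only: real_norm_def mult_ac)
  also have "\<dots> \<le> (4 * M) * ((2 * bracket (b$1)) * (2 * bracket (b$2)) * (2 * bracket s))"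
  proof (rule mult_mono)
    have "(1 + \<bar>a\<bar>) * (1 + 1 / \<bar>a\<bar>) = 2 + \<bar>a\<bar> + 1 / \<bar>a\<bar>" using a by (simp add: field_simps)
    then show "(1 + \<bar>a\<bar>) * (1 + 1 / \<bar>a\<bar>) \<le> 4 * M" using M by linarith
    show "(1 + norm (b$1)) * (1 + norm (b$2)) * (1 + norm s)
        \<le> (2 * bracket (b$1)) * (2 * bracket (b$2)) * (2 * bracket s)"
      by (intro mult_mono one_plus_norm_le_bracket mult_nonneg_nonneg) (simp_all add: bracket_pos less_imp_le)
  qed (use M(3) in simp_all)
  also have "\<dots> = 32 * (M * (bracket (b$1) * bracket (b$2) * bracket s))" by simp
  finally have "param_weight (a, s, b) ^ n \<le> (32 * (M * (bracket (b$1) * bracket (b$2) * bracket s))) ^ n"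
    using param_weight_ge(1)[of "(a, s, b)"] by (intro power_mono) auto
  also have "\<dots> = 32 ^ n * (bracket (b$1) ^ n * bracket (b$2) ^ n * bracket s ^ n * M ^ n)"
    by (simp only: power_mult_distrib mult_ac)
  also have "\<dots> \<le> 32 ^ n * (bracket (b$1) ^ n * bracket (b$2) ^ n * bracket s ^ n * (\<bar>a\<bar> ^ n + 1 / \<bar>a\<bar> ^ n))"
  proof (intro mult_left_mono)
    show "M ^ n \<le> \<bar>a\<bar> ^ n + 1 / \<bar>a\<bar> ^ n"
      by (cases "\<bar>a\<bar> \<le> 1 / \<bar>a\<bar>") (simp_all add: M_def max_def power_one_over)
  qed (simp_all add: bracket_pos less_imp_le)
  finally show ?thesis by (simp add: shearlet_factor_def)
qed

lemma powr_le_param_weight: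
  assumes "fst \<omega> \<noteq> 0"
  shows "\<bar>fst \<omega>\<bar> powr (- 15 / 4) \<le> param_weight \<omega> ^ 4"
proof -
  let ?a = "\<bar>fst \<omega>\<bar>"
  have "?a powr (- 15 / 4) = (1 / ?a) powr (15 / 4)"
    using assms by (simp add: powr_divide powr_minus inverse_eq_divide minus_divide_left[symmetric] del: minus_divide_left)
  also have "\<dots> \<le> (1 + 1 / ?a) powr (15 / 4)" by (intro powr_mono2) auto
  also have "\<dots> \<le> (1 + 1 / ?a) powr 4" by (intro powr_mono) auto
  also have "\<dots> = (1 + 1 / ?a) ^ 4" using assms by (subst powr_numeral) (auto simp: add_pos_pos)
  also have "\<dots> \<le> param_weight \<omega> ^ 4" by (intro power_mono param_weight_ge) auto
  finally show ?thesis .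
qed

lemma synthesis_density_zero: "fst \<omega> = 0 \<Longrightarrow> synthesis_density \<Phi> \<omega> = 0"
  by (simp add: synthesis_density_def)

lemma synthesis_density_bound:
  assumes \<Phi>: "\<Phi> \<in> shearlet_test"
    and B: "\<And>y. y \<in> shearlet_group \<Longrightarrow> shearlet_weight (n + 4) (n + 4) (n + 4) (n + 4) 0 0 0 0 \<Phi> y \<le> B"
  shows "param_weight \<omega> ^ n * norm (synthesis_density \<Phi> \<omega>) \<le> 32 ^ (n + 4) * B"
proof (cases "fst \<omega> = 0")
  case True
  have "0 \<le> shearlet_weight (n + 4) (n + 4) (n + 4) (n + 4) 0 0 0 0 \<Phi> (0, 0, 1)"
    unfolding shearlet_weight_factor by (intro mult_nonneg_nonneg shearlet_factor_nonneg) simp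
  also have "\<dots> \<le> B" by (rule B) (simp add: shearlet_group_def)
  finally show ?thesis using True by (simp add: synthesis_density_def)
next
  case False
  obtain a s b where \<omega>: "\<omega> = (a, s, b)" by (cases \<omega>)
  have a: "a \<noteq> 0" using False \<omega> by simp
  have W: "0 \<le> param_weight \<omega>" using param_weight_ge(1)[of \<omega>] by linarith
  have "param_weight \<omega> ^ n * norm (synthesis_density \<Phi> \<omega>) =
      param_weight \<omega> ^ n * \<bar>fst \<omega>\<bar> powr (- 15 / 4) * norm (\<Phi> (b, s, a))"
    by (simp add: synthesis_density_def \<omega> norm_mult)
  also have "\<dots> \<le> param_weight \<omega> ^ n * param_weight \<omega> ^ 4 * norm (\<Phi> (b, s, a))"
    using W by (intro mult_right_mono mult_left_mono powr_le_param_weight False) auto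
  also have "\<dots> = param_weight \<omega> ^ (n + 4) * norm (\<Phi> (b, s, a))" by (simp only: power_add)
  also have "\<dots> \<le> (32 ^ (n + 4) * shearlet_factor (n + 4) (n + 4) (n + 4) (n + 4) (b, s, a)) * norm (\<Phi> (b, s, a))"
    unfolding \<omega> by (intro mult_right_mono param_weight_power_le a) simp
  also have "\<dots> = 32 ^ (n + 4) * shearlet_weight (n + 4) (n + 4) (n + 4) (n + 4) 0 0 0 0 \<Phi> (b, s, a)"
    by (simp add: shearlet_weight_factor shearlet_directions_def)
  also have "\<dots> \<le> 32 ^ (n + 4) * B"
    by (intro mult_left_mono B) (simp_all add: shearlet_group_def a)
  finally show ?thesis .
qed

lemma shearlet_test_borel_measurable:
  assumes \<Phi>: "\<Phi> \<in> shearlet_test"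
  shows "\<Phi> \<in> borel_measurable borel"
proof -
  have "(\<lambda>y. indicator shearlet_group y *\<^sub>R \<Phi> y) \<in> borel_measurable borel"
    by (intro borel_measurable_continuous_on_indicator smooth_on_continuous_on shearlet_testD(1)[OF \<Phi>])
      (simp add: open_shearlet_group)
  also have "(\<lambda>y. indicator shearlet_group y *\<^sub>R \<Phi> y) = \<Phi>"
    using shearlet_testD(3)[OF \<Phi>] by (auto simp: indicator_def)
  finally show ?thesis .
qed

lemma rapid_synthesis_density:
  assumes \<Phi>: "\<Phi> \<in> shearlet_test"
  shows "rapid (synthesis_density \<Phi>)"
  unfolding rapid_def
proof (intro conjI allI impI)
  note [measurable] = shearlet_test_borel_measurable[OF \<Phi>]
  show "synthesis_density \<Phi> \<in> borel_measurable borel" unfolding synthesis_density_def by measurable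
  show "synthesis_density \<Phi> \<omega> = 0" if "fst \<omega> = 0" for \<omega> by (rule synthesis_density_zero[OF that])
  fix n
  obtain B where "\<And>y. y \<in> shearlet_group \<Longrightarrow> shearlet_weight (n + 4) (n + 4) (n + 4) (n + 4) 0 0 0 0 \<Phi> y \<le> B"
    using shearlet_testE[OF \<Phi>] by blast
  from synthesis_density_bound[OF \<Phi> this]
  show "\<exists>B. \<forall>\<omega>. param_weight \<omega> ^ n * norm (synthesis_density \<Phi> \<omega>) \<le> B" by blast
qed

lemma shearlet_synthesis_eq_superpose:
  assumes \<psi>: "\<psi> \<in> schwartz" and \<Phi>: "\<Phi> \<in> shearlet_test"
  shows "shearlet_synthesis \<psi> \<Phi> x = superpose \<psi> (synthesis_density \<Phi>) x"
proof -
  define F where "F = synthesis_density \<Phi>"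
  have F: "rapid F" unfolding F_def by (rule rapid_synthesis_density[OF \<Phi>])
  let ?K = "shearlet_kernel \<psi> F x"
  note [measurable] = schwartz_borel_measurable[OF \<psi>] rapidD(1)[OF F]
  have eq: "\<Phi> (b, s, a) * shearlet_rep b s a \<psi> x * complex_of_real (\<bar>a\<bar> powr (- 3)) = ?K (a, s, b)"
    if "a \<noteq> 0" for a s b
  proof -
    have "\<bar>a\<bar> powr (- 3 / 4) * \<bar>a\<bar> powr (- 3) = \<bar>a\<bar> powr (- 15 / 4)"
      by (simp add: powr_add[symmetric])
    then have "complex_of_real (\<bar>a\<bar> powr (- 3 / 4)) * complex_of_real (\<bar>a\<bar> powr (- 3)) = complex_of_real (\<bar>a\<bar> powr (- 15 / 4))"
      by (simp only: of_real_mult[symmetric])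
    moreover have "u * (v * w) * z = u * (v * z) * w" for u v w z :: complex by (simp add: mult_ac)
    ultimately show ?thesis
      unfolding shearlet_rep_coord[OF that] shearlet_kernel_def F_def synthesis_density_def fst_conv snd_conv
      by (simp only:)
  qed
  have inner: "integrable lborel (\<lambda>p. ?K (a, p))" for a
  proof -
    obtain C where C: "\<forall>F B x \<omega>. rapid F \<longrightarrow>
        (\<forall>\<omega>. param_weight \<omega> ^ (2 * 0 + 6) * norm (F \<omega>) \<le> B) \<longrightarrow>
        (1 + norm x) ^ 0 * norm (shearlet_kernel \<psi> F x \<omega>) \<le> C * B / (1 + norm \<omega>) ^ 6" and C0: "0 \<le> C"
      using shearlet_kernel_bound[OF \<psi>, of 0 6] by (elim exE conjE)
    obtain B where B0: "B \<ge> 0" and B: "\<And>\<omega>. param_weight \<omega> ^ (2 * 0 + 6) * norm (F \<omega>) \<le> B"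
      using rapidE[OF F, of "2 * 0 + 6"] by blast
    show ?thesis
    proof (rule integrable_norm_power_bound[where n = 6])
      show "(\<lambda>p. ?K (a, p)) \<in> borel_measurable borel" by measurable
      fix p :: "real \<times> (real^2)"
      have "norm (?K (a, p)) \<le> C * B / (1 + norm (a, p)) ^ 6"
        using C[rule_format, OF F B, of x "(a, p)"] by simp
      also have "\<dots> \<le> C * B / (1 + norm p) ^ 6"
        using norm_snd_le[of p a] B0 C0
        by (intro divide_left_mono power_mono mult_pos_pos zero_less_power mult_nonneg_nonneg) (auto simp: add_pos_nonneg)
      finally show "norm (?K (a, p)) \<le> C * B / (1 + norm p) ^ 6" .
    qed simp
  qed
  have "shearlet_synthesis \<psi> \<Phi> x = (\<integral>a. \<integral>s. \<integral>b. ?K (a, s, b) \<partial>lborel \<partial>lborel \<partial>lborel)"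
    unfolding shearlet_synthesis_def set_lebesgue_integral_def
  proof (rule Bochner_Integration.integral_cong[OF refl])
    fix a :: real
    show "indicat_real (- {0}) a *\<^sub>R (\<integral>s. \<integral>b. \<Phi> (b, s, a) * shearlet_rep b s a \<psi> x *
        complex_of_real (\<bar>a\<bar> powr (- 3)) \<partial>lborel \<partial>lborel) = (\<integral>s. \<integral>b. ?K (a, s, b) \<partial>lborel \<partial>lborel)"
    proof (cases "a = 0")
      case True
      then show ?thesis using rapidD(2)[OF F] by (simp add: shearlet_kernel_def)
    next
      case False
      then show ?thesis by (simp add: eq)
    qed
  qed
  also have "\<dots> = (\<integral>a. \<integral>p. ?K (a, p) \<partial>lborel \<partial>lborel)"
  proof (rule Bochner_Integration.integral_cong[OF refl])
    fix a :: real
    have "integrable (lborel \<Otimes>\<^sub>M lborel) (\<lambda>p. ?K (a, p))" unfolding lborel_prod by (rule inner)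
    from lborel_pair.integral_fst'[OF this]
    show "(\<integral>s. \<integral>b. ?K (a, s, b) \<partial>lborel \<partial>lborel) = (\<integral>p. ?K (a, p) \<partial>lborel)"
      unfolding lborel_prod .
  qed
  also have "\<dots> = (\<integral>\<omega>. ?K \<omega> \<partial>lborel)"
  proof -
    have "integrable (lborel \<Otimes>\<^sub>M lborel) ?K" unfolding lborel_prod by (rule integrable_shearlet_kernel[OF \<psi> F])
    from lborel_pair.integral_fst'[OF this] show ?thesis unfolding lborel_prod .
  qed
  finally show ?thesis unfolding superpose_def F_def .
qed

lemma linear_shearlet_synthesis:
  assumes \<psi>: "\<psi> \<in> schwartz"
  shows "linear_operator_on shearlet_test (shearlet_synthesis \<psi>)"
  unfolding linear_operator_on_def
proof (intro conjI ballI allI)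
  note V = function_subspaceD[OF shearlet_test_subspace]
  fix \<Phi> \<Psi> assume \<Phi>: "\<Phi> \<in> shearlet_test" and \<Psi>: "\<Psi> \<in> shearlet_test"
  have "superpose \<psi> (synthesis_density (\<lambda>x. \<Phi> x + \<Psi> x)) x =
      superpose \<psi> (synthesis_density \<Phi>) x + superpose \<psi> (synthesis_density \<Psi>) x" for x
  proof -
    have "shearlet_kernel \<psi> (synthesis_density (\<lambda>x. \<Phi> x + \<Psi> x)) x = (\<lambda>\<omega>.
        shearlet_kernel \<psi> (synthesis_density \<Phi>) x \<omega> + shearlet_kernel \<psi> (synthesis_density \<Psi>) x \<omega>)"
      by (rule ext) (simp only: shearlet_kernel_def synthesis_density_def distrib_right)
    then show ?thesis
      unfolding superpose_def
      by (simp only:) (intro Bochner_Integration.integral_add integrable_shearlet_kernel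
        rapid_synthesis_density \<psi> \<Phi> \<Psi>)
  qed
  then show "shearlet_synthesis \<psi> (\<lambda>x. \<Phi> x + \<Psi> x) = (\<lambda>y. shearlet_synthesis \<psi> \<Phi> y + shearlet_synthesis \<psi> \<Psi> y)"
    by (intro ext) (simp add: shearlet_synthesis_eq_superpose[OF \<psi>] \<Phi> \<Psi> V(2))
next
  note V = function_subspaceD[OF shearlet_test_subspace]
  fix c \<Phi> assume \<Phi>: "\<Phi> \<in> shearlet_test"
  have "superpose \<psi> (synthesis_density (\<lambda>x. c * \<Phi> x)) x = c * superpose \<psi> (synthesis_density \<Phi>) x" for x
  proof -
    have "shearlet_kernel \<psi> (synthesis_density (\<lambda>x. c * \<Phi> x)) x =
        (\<lambda>\<omega>. c * shearlet_kernel \<psi> (synthesis_density \<Phi>) x \<omega>)"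
      by (rule ext) (simp only: shearlet_kernel_def synthesis_density_def mult.assoc)
    then show ?thesis
      unfolding superpose_def by (simp only: integral_mult_right_zero)
  qed
  then show "shearlet_synthesis \<psi> (\<lambda>x. c * \<Phi> x) = (\<lambda>y. c * shearlet_synthesis \<psi> \<Phi> y)"
    by (intro ext) (simp add: shearlet_synthesis_eq_superpose[OF \<psi>] \<Phi> V(3))
qed

theorem continuous_shearlet_synthesis:
  assumes \<psi>: "\<psi> \<in> lizorkin"
  shows "continuous_map shearlet_test_topology lizorkin_topology (shearlet_synthesis \<psi>)"
proof -
  note \<psi>S = lizorkinD(1)[OF \<psi>]
  note top = topspace_shearlet_test_topology
  have synth: "shearlet_synthesis \<psi> \<Phi> = superpose \<psi> (synthesis_density \<Phi>)" if "\<Phi> \<in> shearlet_test" for \<Phi>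
    using shearlet_synthesis_eq_superpose[OF \<psi>S that] by auto
  have range: "shearlet_synthesis \<psi> \<Phi> \<in> lizorkin" if "\<Phi> \<in> shearlet_test" for \<Phi>
    unfolding synth[OF that] by (rule superpose_lizorkin[OF \<psi> rapid_synthesis_density[OF that]])
  have "continuous_map shearlet_test_topology schwartz_topology (shearlet_synthesis \<psi>)"
    unfolding schwartz_topology_def
  proof (rule continuous_map_seminorm_topologyI)
    show "p (\<lambda>x. 0) = 0" if "p \<in> {\<lambda>\<phi>. SUP x. schwartz_weight k \<alpha>1 \<alpha>2 \<phi> x |k \<alpha>1 \<alpha>2. True}" for p
      using that by (auto simp: schwartz_weight_foldr foldr_partial_zero simp del: foldr_append)
    show "shearlet_synthesis \<psi> \<Phi> \<in> schwartz" if "\<Phi> \<in> topspace shearlet_test_topology" for \<Phi>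
      using range that lizorkinD(1) top by auto
  next
    fix p f g h
    assume p: "p \<in> {\<lambda>\<phi>. SUP x. schwartz_weight k \<alpha>1 \<alpha>2 \<phi> x |k \<alpha>1 \<alpha>2. True}"
      and f: "f \<in> schwartz" and g: "g \<in> schwartz" and h: "h \<in> schwartz"
    then obtain k \<alpha>1 \<alpha>2 where p: "p = (\<lambda>\<phi>. SUP x. schwartz_weight k \<alpha>1 \<alpha>2 \<phi> x)" by blast
    note d = function_subspace_diff[OF schwartz_subspace]
    show "p (\<lambda>x. f x - h x) \<le> p (\<lambda>x. f x - g x) + p (\<lambda>x. g x - h x)"
      unfolding p
    proof (rule cSUP_least)
      fix x
      have "schwartz_weight k \<alpha>1 \<alpha>2 (\<lambda>x. f x - h x) x \<le>
          schwartz_weight k \<alpha>1 \<alpha>2 (\<lambda>x. f x - g x) x + schwartz_weight k \<alpha>1 \<alpha>2 (\<lambda>x. g x - h x) x"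
        using schwartz_weight_add[OF d[OF f g] d[OF g h], of k \<alpha>1 \<alpha>2 x] by simp
      also have "\<dots> \<le> (SUP x. schwartz_weight k \<alpha>1 \<alpha>2 (\<lambda>x. f x - g x) x) + (SUP x. schwartz_weight k \<alpha>1 \<alpha>2 (\<lambda>x. g x - h x) x)"
        by (intro add_mono cSUP_upper schwartz_weight_bdd d f g h) auto
      finally show "schwartz_weight k \<alpha>1 \<alpha>2 (\<lambda>x. f x - h x) x \<le>
          (SUP x. schwartz_weight k \<alpha>1 \<alpha>2 (\<lambda>x. f x - g x) x) + (SUP x. schwartz_weight k \<alpha>1 \<alpha>2 (\<lambda>x. g x - h x) x)" .
    qed simp
  next
    fix p \<Phi> and e :: real
    assume p: "p \<in> {\<lambda>\<phi>. SUP x. schwartz_weight k \<alpha>1 \<alpha>2 \<phi> x |k \<alpha>1 \<alpha>2. True}"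
      and \<Phi>: "\<Phi> \<in> topspace shearlet_test_topology" and e: "0 < e"
    then obtain k \<alpha>1 \<alpha>2 where p: "p = (\<lambda>\<phi>. SUP x. schwartz_weight k \<alpha>1 \<alpha>2 \<phi> x)" by blast
    have \<Phi>: "\<Phi> \<in> shearlet_test" using \<Phi> top by simp
    obtain n C where C: "\<forall>F B x. rapid F \<longrightarrow> (\<forall>\<omega>. param_weight \<omega> ^ n * norm (F \<omega>) \<le> B) \<longrightarrow>
        schwartz_weight k \<alpha>1 \<alpha>2 (superpose \<psi> F) x \<le> C * B"
      using superpose_schwartz_weight_bound[OF \<psi>S, of k \<alpha>1 \<alpha>2] by (elim exE)
    let ?w = "shearlet_weight (n + 4) (n + 4) (n + 4) (n + 4) 0 0 0 0"
    define D where "D = \<bar>C * 32 ^ (n + 4)\<bar>"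
    define \<delta> where "\<delta> = e / (2 * (D + 1))"
    have D: "0 \<le> D" by (simp add: D_def)
    have \<delta>: "0 < \<delta>" "D * \<delta> \<le> e / 2" using e D by (auto simp: \<delta>_def field_simps)
    let ?U = "{\<Psi> \<in> shearlet_test. (SUP y\<in>shearlet_group. ?w (\<lambda>y. \<Psi> y - \<Phi> y) y) < \<delta>}"
    have "openin shearlet_test_topology ?U"
      unfolding shearlet_test_topology_def
      by (rule openin_seminorm_ball[where p = "\<lambda>\<Phi>. SUP y\<in>shearlet_group. ?w \<Phi> y", OF _ \<Phi> \<delta>(1)]) blast
    moreover have "\<Phi> \<in> ?U"
      using \<Phi> \<delta>(1) by (simp add: shearlet_weight_factor foldr_partial_zero shearlet_group_nonempty)
    moreover have "p (\<lambda>x. shearlet_synthesis \<psi> \<Psi> x - shearlet_synthesis \<psi> \<Phi> x) < e" if \<Psi>: "\<Psi> \<in> ?U" for \<Psi>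
    proof -
      let ?d = "\<lambda>y. \<Psi> y - \<Phi> y"
      have \<Psi>T: "\<Psi> \<in> shearlet_test" using \<Psi> by blast
      have d: "?d \<in> shearlet_test" by (rule function_subspace_diff[OF shearlet_test_subspace \<Psi>T \<Phi>])
      have "?w ?d y \<le> \<delta>" if "y \<in> shearlet_group" for y
      proof -
        have "?w ?d y \<le> (SUP y\<in>shearlet_group. ?w ?d y)"
          by (rule cSUP_upper[OF that shearlet_testD(2)[OF d]])
        also have "\<dots> < \<delta>" using \<Psi> by simp
        finally show ?thesis by simp
      qed
      then have "param_weight \<omega> ^ n * norm (synthesis_density ?d \<omega>) \<le> 32 ^ (n + 4) * \<delta>" for \<omega>
        by (rule synthesis_density_bound[OF d])
      then have "schwartz_weight k \<alpha>1 \<alpha>2 (shearlet_synthesis \<psi> ?d) x \<le> C * (32 ^ (n + 4) * \<delta>)" for x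
        unfolding synth[OF d] using C rapid_synthesis_density[OF d] by blast
      moreover have "C * (32 ^ (n + 4) * \<delta>) \<le> D * \<delta>"
        using \<delta>(1) unfolding D_def by (simp only: mult.assoc[symmetric]) (intro mult_right_mono abs_ge_self, simp)
      ultimately have le: "schwartz_weight k \<alpha>1 \<alpha>2 (shearlet_synthesis \<psi> ?d) x \<le> e / 2" for x
        by (rule order_trans[OF _ order_trans[OF _ \<delta>(2)]])
      have "shearlet_synthesis \<psi> (\<lambda>y. ?d y + \<Phi> y) = (\<lambda>x. shearlet_synthesis \<psi> ?d x + shearlet_synthesis \<psi> \<Phi> x)"
        by (rule linear_operator_onD(1)[OF linear_shearlet_synthesis[OF \<psi>S] d \<Phi>])
      then have "(\<lambda>x. shearlet_synthesis \<psi> \<Psi> x - shearlet_synthesis \<psi> \<Phi> x) = shearlet_synthesis \<psi> ?d" by simp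
      then have "p (\<lambda>x. shearlet_synthesis \<psi> \<Psi> x - shearlet_synthesis \<psi> \<Phi> x) \<le> e / 2"
        unfolding p by (simp only:) (rule cSUP_least, simp, rule le)
      then show ?thesis using e by linarith
    qed
    ultimately show "\<exists>U. openin shearlet_test_topology U \<and> \<Phi> \<in> U \<and>
        (\<forall>\<Psi>\<in>U. p (\<lambda>x. shearlet_synthesis \<psi> \<Psi> x - shearlet_synthesis \<psi> \<Phi> x) < e)"
      by (intro exI[of _ ?U] conjI ballI)
  qed auto
  then show ?thesis
    unfolding lizorkin_topology_def continuous_map_in_subtopology using range top by auto
qed

lemma linear_shearlet_transform:
  assumes \<psi>: "\<psi> \<in> schwartz"
  shows "linear_operator_on schwartz (shearlet_transform \<psi>)"
proof -
  have int: "integrable lborel (\<lambda>x. f x * cnj (shearlet_rep b s a \<psi> x))"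
    if f: "f \<in> schwartz" and a: "a \<noteq> 0" for f b s a
  proof -
    note [measurable] = schwartz_borel_measurable[OF \<psi>] schwartz_borel_measurable[OF f]
    obtain C where C: "\<And>z. (1 + norm z) ^ 0 * norm (\<psi> z) \<le> C" using schwartz_norm_power_bound[OF \<psi>] by blast
    have "integrable lborel (\<lambda>x. complex_of_real (x$1 ^ 0 * x$2 ^ 0) * f x)"
      by (rule integrable_monomial_schwartz[OF f])
    then have "integrable lborel (\<lambda>x. (\<bar>a\<bar> powr (- 3 / 4) * C) * norm (f x))" by simp
    then show ?thesis
    proof (rule Bochner_Integration.integrable_bound)
      have [measurable]: "cnj \<in> borel_measurable borel" by (intro borel_measurable_continuous_onI continuous_intros)
      show "(\<lambda>x. f x * cnj (shearlet_rep b s a \<psi> x)) \<in> borel_measurable lborel"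
        unfolding shearlet_rep_coord[OF a] by measurable
      show "AE x in lborel. norm (f x * cnj (shearlet_rep b s a \<psi> x)) \<le> norm ((\<bar>a\<bar> powr (- 3 / 4) * C) * norm (f x))"
      proof (rule AE_I2)
        fix x
        have "norm (f x * cnj (shearlet_rep b s a \<psi> x)) =
            (\<bar>a\<bar> powr (- 3 / 4) * norm (\<psi> (shear_coord (a, s, b) (x - b)))) * norm (f x)"
          unfolding shearlet_rep_coord[OF a] by (simp add: norm_mult)
        also have "\<dots> \<le> (\<bar>a\<bar> powr (- 3 / 4) * C) * norm (f x)"
          using C by (intro mult_right_mono mult_left_mono) auto
        also have "\<dots> \<le> norm ((\<bar>a\<bar> powr (- 3 / 4) * C) * norm (f x))" unfolding real_norm_def by (rule abs_ge_self)
        finally show "norm (f x * cnj (shearlet_rep b s a \<psi> x)) \<le> norm ((\<bar>a\<bar> powr (- 3 / 4) * C) * norm (f x))" .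
      qed
    qed
  qed
  show ?thesis
    unfolding linear_operator_on_def
    by (auto simp: shearlet_transform_def fun_eq_iff distrib_right mult.assoc int)
qed

theorem proposition10:
  fixes \<psi> :: "real^2 \<Rightarrow> complex"
  assumes "\<psi> \<in> lizorkin"
  shows "continuous_linear_operator
           (strong_dual lizorkin_topology) (strong_dual shearlet_test_topology)
           (dist_shearlet_transform \<psi>) \<and>
         (continuous_map lizorkin_topology shearlet_test_topology
            (shearlet_transform (\<lambda>x. cnj (\<psi> x))) \<longrightarrow>
          continuous_linear_operator
           (strong_dual shearlet_test_topology) (strong_dual lizorkin_topology)
           (dist_shearlet_synthesis \<psi>))"
proof (intro conjI impI)
  note top = topspace_shearlet_test_topology topspace_lizorkin_topology
  note sub = shearlet_test_subspace[folded top] lizorkin_subspace[folded top]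
  note \<psi>c = lizorkin_cnj[OF assms]
  have "linear_operator_on (topspace shearlet_test_topology) (shearlet_synthesis (\<lambda>x. cnj (\<psi> x)))"
    unfolding top by (rule linear_shearlet_synthesis[OF lizorkinD(1)[OF \<psi>c]])
  from continuous_linear_operator_transpose[OF sub this continuous_shearlet_synthesis[OF \<psi>c]]
  show "continuous_linear_operator (strong_dual lizorkin_topology) (strong_dual shearlet_test_topology)
      (dist_shearlet_transform \<psi>)"
    unfolding top dist_shearlet_transform_def[abs_def] .
  assume cont: "continuous_map lizorkin_topology shearlet_test_topology (shearlet_transform (\<lambda>x. cnj (\<psi> x)))"
  have "linear_operator_on (topspace lizorkin_topology) (shearlet_transform (\<lambda>x. cnj (\<psi> x)))"
    unfolding top using linear_shearlet_transform[OF lizorkinD(1)[OF \<psi>c]]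
    unfolding linear_operator_on_def lizorkin_def by simp
  from continuous_linear_operator_transpose[OF sub(2,1) this cont]
  show "continuous_linear_operator (strong_dual shearlet_test_topology) (strong_dual lizorkin_topology)
      (dist_shearlet_synthesis \<psi>)"
    unfolding top dist_shearlet_synthesis_def[abs_def] .
qed

end
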